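(* Let $p,n\ge 1$, $d_1\ge\cdots\ge d_p>0$, $D=\mathrm{diag}(d_1,\dots,d_p)$, $C=\mathrm{diag}(c_1,\dots,c_p)$ with $c_i\ge 1$ for all $i$, $\gamma\ge1$ and $j\in\mathbb{R}$. Suppose $(X',Z')'\in\mathbb{R}^p\times\mathbb{R}^n$ has density $\prod_i d_i^{-1/2}\,\sigma^{-p-n} f(\{(x-\theta)'D^{-1}(x-\theta)+z'z\}/\sigma^2)$ with $\theta\in\mathbb{R}^p$, $\sigma>0$ unknown. Let $S=Z'Z$, $W=X'C^{-1}D^{-1}X/S$ and $$\hat\theta_{\mathrm{SB}}=\left(I-\frac{\alpha}{\gamma(\alpha+1)+W}C^{-1}\right)X.$$ If $c_1,\dots,c_p$ are chosen so that $$0<\alpha\le\frac{2}{n+2}\left(\frac{\sum_{i=1}^p d_i^{1-j}/c_i}{\max_{1\le i\le p} d_i^{1-j}/c_i}-2\right),$$ then $\hat\theta_{\mathrm{SB}}$ is minimax under the loss $L_j(\delta,\theta,\sigma^2)=(\delta-\theta)'D^{-j}(\delta-\theta)/\sigma^2$.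
   Context: Here $f:[0,\infty)\to[0,\infty)$ is a fixed function such that the displayed expression is a probability density and $X$ has finite second moments (this includes the normal case). The risk is $R_j(\delta,\theta,\sigma^2)=E[L_j(\delta(X,Z),\theta,\sigma^2)]$. The estimator $X$ is minimax with constant risk, so $\delta$ is minimax if and only if $R_j(\delta,\theta,\sigma^2)\le R_j(X,\theta,\sigma^2)$ for all $\theta\in\mathbb{R}^p$ and $\sigma>0$. *)

theory Defs
  imports "HOL-Probability.Probability"
begin

definition diag :: "('p::finite \<Rightarrow> real) \<Rightarrow> real^'p^'p" where
  "diag a = (\<chi> i k. if i = k then a i else 0)"

text \<open>Real powers of a diagonal matrix; only used for positive diagonal entries.\<close>

definition diag_powr :: "('p::finite \<Rightarrow> real) \<Rightarrow> real \<Rightarrow> real^'p^'p" where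
  "diag_powr a r = diag (\<lambda>i. a i powr r)"

text \<open>Joint law of the pair of observations with location \<open>\<theta>\<close>, scale \<open>\<sigma>\<close> and radial
  density \<open>f\<close>. The generator is only ever evaluated on nonnegative reals.\<close>

definition model ::
  "('p::finite \<Rightarrow> real) \<Rightarrow> (real \<Rightarrow> real) \<Rightarrow> real^'p \<Rightarrow> real \<Rightarrow> ((real^'p) \<times> (real^'n::finite)) measure"
where
  "model d f \<theta> \<sigma> = density lborel (\<lambda>(x, z). ennreal (
     (\<Prod>i\<in>UNIV. d i powr (- 1 / 2)) * \<sigma> powr (- real CARD('p) - real CARD('n)) *
     f (((x - \<theta>) \<bullet> (matrix_inv (diag d) *v (x - \<theta>)) + z \<bullet> z) / \<sigma>\<^sup>2)))"

definition loss ::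
  "('p::finite \<Rightarrow> real) \<Rightarrow> real \<Rightarrow> real^'p \<Rightarrow> real^'p \<Rightarrow> real \<Rightarrow> real"
where
  "loss d j a \<theta> \<sigma>2 = ((a - \<theta>) \<bullet> (diag_powr d (- j) *v (a - \<theta>))) / \<sigma>2"

text \<open>The loss is nonnegative, so its expectation is taken in the extended nonnegative reals;
  an estimator may thus have infinite risk.\<close>

definition risk ::
  "('p::finite \<Rightarrow> real) \<Rightarrow> (real \<Rightarrow> real) \<Rightarrow> real \<Rightarrow> ((real^'p) \<times> (real^'n::finite) \<Rightarrow> real^'p) \<Rightarrow>
   real^'p \<Rightarrow> real \<Rightarrow> ennreal"
where
  "risk d f j \<delta> \<theta> \<sigma> = (\<integral>\<^sup>+ y. ennreal (loss d j (\<delta> y) \<theta> (\<sigma>\<^sup>2)) \<partial>(model d f \<theta> \<sigma>))"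

definition max_risk ::
  "('p::finite \<Rightarrow> real) \<Rightarrow> (real \<Rightarrow> real) \<Rightarrow> real \<Rightarrow> ((real^'p) \<times> (real^'n::finite) \<Rightarrow> real^'p) \<Rightarrow> ennreal"
where
  "max_risk d f j \<delta> = (SUP (\<theta>, \<sigma>)\<in>UNIV \<times> {0<..}. risk d f j \<delta> \<theta> \<sigma>)"

definition minimax ::
  "('p::finite \<Rightarrow> real) \<Rightarrow> (real \<Rightarrow> real) \<Rightarrow> real \<Rightarrow> ((real^'p) \<times> (real^'n::finite) \<Rightarrow> real^'p) \<Rightarrow> bool"
where
  "minimax d f j \<delta> \<longleftrightarrow> \<delta> \<in> borel_measurable borel \<and>
     (\<forall>\<delta>' :: (real^'p) \<times> (real^'n) \<Rightarrow> real^'p.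
       \<delta>' \<in> borel_measurable borel \<longrightarrow> max_risk d f j \<delta> \<le> max_risk d f j \<delta>')"

text \<open>On the null set \<open>z = 0\<close> this statistic is \<open>0\<close>, by the convention for division by zero.\<close>

definition W_stat ::
  "('p::finite \<Rightarrow> real) \<Rightarrow> ('p \<Rightarrow> real) \<Rightarrow> real^'p \<Rightarrow> real^'n::finite \<Rightarrow> real"
where
  "W_stat d c x z = (x \<bullet> ((matrix_inv (diag c) ** matrix_inv (diag d)) *v x)) / (z \<bullet> z)"

definition theta_SB ::
  "('p::finite \<Rightarrow> real) \<Rightarrow> ('p \<Rightarrow> real) \<Rightarrow> real \<Rightarrow> real \<Rightarrow> (real^'p) \<times> (real^'n::finite) \<Rightarrow> real^'p"
where
  "theta_SB d c \<alpha> \<gamma> = (\<lambda>(x, z).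
     (mat 1 - (\<alpha> / (\<gamma> * (\<alpha> + 1) + W_stat d c x z)) *\<^sub>R matrix_inv (diag c)) *v x)"

end

theory Submission imports Defs begin

text \<open>
  The bound on \<open>X\<close> is the Girshick--Savage argument: under a uniform prior on a cube, the average
  risk of any estimator is bounded below by a quantity that tends to the constant risk of \<open>X\<close> as
  the cube grows.

  For the risk comparison, pass to coordinates in which the density is \<open>f(|y|\<^sup>2)\<close>. With
  \<open>F(r) = (1/2) \<integral>\<^sub>r\<^sup>\<infinity> f\<close>, Stein's identity reads
  \<open>\<integral> y \<bullet> V(y) f(|y|\<^sup>2) dy = \<integral> div V(y) F(|y|\<^sup>2) dy\<close>. The loss of the shrinkage estimator
  minus the loss of \<open>X\<close> has the form \<open>y \<bullet> V\<close>: the cross term is already of this form in the location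
  coordinates, and the square \<open>\<phi>\<^sup>2 A\<close> is the \<open>z\<close>-part \<open>z \<bullet> (z \<phi>\<^sup>2 A / |z|\<^sup>2)\<close>. The condition on
  \<open>\<alpha>\<close> makes \<open>div V \<le> 0\<close> pointwise.
\<close>

subsection \<open>Stein's identity for spherically symmetric densities\<close>

text \<open>As F has derivative -f/2, the gradient of F(|y|^2) is formally -y f(|y|^2), and Stein's
  identity is an integration by parts. The obstacle is that f is merely measurable and that F may be
  infinite at 0. The identity is therefore proved first for nonnegative integrands, by Tonelli and a
  change of variables, and signed functions are reduced to that case afterwards. The measure with
  generator F is the same for every coordinate; this is what allows the location part and the scale
  part to be added under one integral and compared pointwise. The constants come from that
  divergence. Differentiating z |z|^2 gives the factor n + 2; differentiating the denominator in the
  cross term, which itself carries a factor 2, gives 4. Cleared of denominators, the bound on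
  \<alpha> reads ((n + 2) \<alpha> + 4) m \<le> 2 s, where s is the sum and m the maximum of the
  d_i^(1-j) / c_i.\<close>

lemma nn_integral_lborel_affine:
  fixes g :: "'a::euclidean_space \<Rightarrow> ennreal" and c :: "'a \<Rightarrow> real" and t :: 'a
  assumes c: "\<And>b. b \<in> Basis \<Longrightarrow> c b \<noteq> 0" and [measurable]: "g \<in> borel_measurable borel"
  shows "(\<integral>\<^sup>+y. g y \<partial>lborel) =
    ennreal (\<Prod>b\<in>Basis. \<bar>c b\<bar>) * (\<integral>\<^sup>+y. g (t + (\<Sum>b\<in>Basis. (c b * (y \<bullet> b)) *\<^sub>R b)) \<partial>lborel)"
proof -
  have "(\<integral>\<^sup>+y. g y \<partial>lborel) =
    (\<integral>\<^sup>+y. g y \<partial>density (distr lborel borel (\<lambda>y. t + (\<Sum>b\<in>Basis. (c b * (y \<bullet> b)) *\<^sub>R b)))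
      (\<lambda>_. ennreal (\<Prod>b\<in>Basis. \<bar>c b\<bar>)))"
    using lborel_affine_euclidean[of c t] c by simp
  then show ?thesis
    by (simp add: nn_integral_density nn_integral_distr nn_integral_cmult)
qed

lemma nn_integral_scale_direction:
  fixes e :: "'a::euclidean_space" and g :: "'a \<Rightarrow> ennreal"
  assumes e: "e \<in> Basis" and r: "r \<noteq> 0" and g: "g \<in> borel_measurable borel"
  shows "(\<integral>\<^sup>+y. g y \<partial>lborel) =
    ennreal \<bar>r\<bar> * (\<integral>\<^sup>+y. g (y + ((r - 1) * (y \<bullet> e)) *\<^sub>R e) \<partial>lborel)"
proof -
  define c where "c = (\<lambda>b. if b = e then r else 1)"
  have c: "(\<Sum>b\<in>Basis. (c b * (y \<bullet> b)) *\<^sub>R b) = y + ((r - 1) * (y \<bullet> e)) *\<^sub>R e" for y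
  proof -
    have "(\<Sum>b\<in>Basis. (c b * (y \<bullet> b)) *\<^sub>R b) =
      (\<Sum>b\<in>Basis. (y \<bullet> b) *\<^sub>R b + (if b = e then ((r - 1) * (y \<bullet> e)) *\<^sub>R e else 0))"
      by (rule sum.cong) (auto simp: c_def algebra_simps)
    also have "\<dots> = y + ((r - 1) * (y \<bullet> e)) *\<^sub>R e"
      using e by (simp add: sum.distrib euclidean_representation)
    finally show ?thesis .
  qed
  have "(\<Prod>b\<in>Basis. \<bar>c b\<bar>) = (\<Prod>b\<in>Basis. if b = e then \<bar>r\<bar> else 1)"
    by (rule prod.cong) (auto simp: c_def)
  also have "\<dots> = \<bar>r\<bar>"
    using e by simp
  finally have p: "(\<Prod>b\<in>Basis. \<bar>c b\<bar>) = \<bar>r\<bar>" .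
  have "\<And>b. b \<in> Basis \<Longrightarrow> c b \<noteq> 0"
    using r by (simp add: c_def)
  from nn_integral_lborel_affine[OF this g, where t = 0] show ?thesis
    by (simp add: c p)
qed

text \<open>Generators take values in \<open>ennreal\<close> because \<open>half_tail f\<close> is
  to be a generator again, and it can be infinite at 0.\<close>

definition radial :: "(real \<Rightarrow> ennreal) \<Rightarrow> 'a::euclidean_space measure" where
  "radial f = density lborel (\<lambda>y. f (y \<bullet> y))"

text \<open>The factor 1/2 cancels the 2 that arises from differentiating
  \<open>y \<bullet> y\<close>.\<close>

definition half_tail :: "(real \<Rightarrow> ennreal) \<Rightarrow> real \<Rightarrow> ennreal" where
  "half_tail f r = ennreal (1 / 2) * (\<integral>\<^sup>+t. f t * indicator {r..} t \<partial>lborel)"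

lemma half_tail_measurable [measurable]:
  assumes [measurable]: "f \<in> borel_measurable borel"
  shows "half_tail f \<in> borel_measurable borel"
proof -
  \<comment> \<open>With \<open>r\<close> inside the set of the indicator, joint measurability in
    \<open>r\<close> and \<open>t\<close> is hidden; the conditional exposes it.\<close>
  have "half_tail f = (\<lambda>r. ennreal (1 / 2) * (\<integral>\<^sup>+t. f t * (if r \<le> t then 1 else 0) \<partial>lborel))"
    by (simp add: half_tail_def indicator_def fun_eq_iff of_bool_def)
  then show ?thesis by simp
qed

lemma sets_radial [simp, measurable_cong]: "sets (radial f) = sets borel"
  by (simp add: radial_def)

lemma space_radial [simp]: "space (radial f) = UNIV"
  by (simp add: radial_def)

lemma nn_integral_radial:
  assumes [measurable]: "f \<in> borel_measurable borel" "g \<in> borel_measurable borel"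
  shows "(\<integral>\<^sup>+y. g y \<partial>radial f) = (\<integral>\<^sup>+y. f (y \<bullet> y) * g y \<partial>lborel)"
  unfolding radial_def by (subst nn_integral_density) auto

lemma AE_lborel_inner_neq_0:
  fixes e :: "'a::euclidean_space"
  assumes "e \<in> Basis"
  shows "AE y in lborel. y \<bullet> e \<noteq> 0"
proof -
  have "negligible {y. e \<bullet> y = 0}"
    using assms by (intro negligible_hyperplane) (auto simp: nonzero_Basis)
  then have "{y. e \<bullet> y = 0} \<in> null_sets lebesgue"
    by (simp add: negligible_iff_null_sets)
  moreover have "{y. e \<bullet> y = 0} \<in> sets borel"
    by (intro borel_closed closed_hyperplane)
  ultimately have "{y. e \<bullet> y = 0} \<in> null_sets lborel"
    by (simp add: null_sets_def)
  from AE_not_in[OF this] show ?thesis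
    by (simp add: inner_commute)
qed

text \<open>For a basis vector \<open>e\<close> this multiplies the \<open>e\<close>-coordinate by
  \<open>r\<close>. Three cases matter: \<open>r = 1 / sqrt \<tau>\<close> in the change of
  variables, \<open>r = 0\<close> as the projection onto the hyperplane orthogonal to
  \<open>e\<close>, and \<open>r = - 1\<close> as the reflection in it.\<close>

definition squeeze :: "'a::euclidean_space \<Rightarrow> real \<Rightarrow> 'a \<Rightarrow> 'a" where
  "squeeze e r y = y + ((r - 1) * (y \<bullet> e)) *\<^sub>R e"

lemma squeeze_measurable [measurable (raw)]:
  assumes [measurable]: "r \<in> borel_measurable M" "y \<in> borel_measurable M"
  shows "(\<lambda>x. squeeze e (r x) (y x)) \<in> borel_measurable M"
  unfolding squeeze_def by measurable

lemma squeeze_inner_self: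
  assumes "e \<in> Basis"
  shows "squeeze e r y \<bullet> squeeze e r y = y \<bullet> y + (r\<^sup>2 - 1) * (y \<bullet> e)\<^sup>2"
  using assms by (simp add: squeeze_def inner_simps inner_commute power2_eq_square algebra_simps)

lemma squeeze_inner:
  assumes "e \<in> Basis"
  shows "squeeze e r y \<bullet> e = r * (y \<bullet> e)"
  using assms by (simp add: squeeze_def inner_simps inner_commute algebra_simps)

text \<open>The substitution t = b + a \<tau> moves the start of the tail to \<tau> = 1. With a =
  \<open>(y \<bullet> e)\<^sup>2\<close> and b = \<open>y \<bullet> y\<close> - a, the domain of
  \<tau> no longer depends on y.\<close>

lemma half_tail_affine:
  assumes [measurable]: "f \<in> borel_measurable borel" and a: "a > 0"
  shows "half_tail f (b + a) = ennreal (a / 2) * (\<integral>\<^sup>+\<tau>. f (b + a * \<tau>) * indicator {1..} \<tau> \<partial>lborel)"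
proof -
  have "(\<integral>\<^sup>+t. f t * indicator {b + a..} t \<partial>lborel) =
      \<bar>a\<bar> * (\<integral>\<^sup>+\<tau>. f (b + a * \<tau>) * indicator {b + a..} (b + a * \<tau>) \<partial>lborel)"
    using a by (intro nn_integral_real_affine) auto
  also have "\<dots> = \<bar>a\<bar> * (\<integral>\<^sup>+\<tau>. f (b + a * \<tau>) * indicator {1..} \<tau> \<partial>lborel)"
    using a by (simp add: indicator_def)
  moreover have "ennreal (1 / 2) * ennreal \<bar>a\<bar> = ennreal (a / 2)"
    using a by (simp only: ennreal_mult[symmetric]) simp
  ultimately show ?thesis
    unfolding half_tail_def by (simp only: mult.assoc[symmetric])
qed

text \<open>The scaling \<open>y \<bullet> e \<mapsto> (y \<bullet> e) / sqrt \<tau>\<close> turns the tail integral of \<open>f\<close> beyond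
  \<open>y \<bullet> y\<close> into an integral over \<open>\<tau> \<ge> 1\<close> that is affine in \<open>\<tau>\<close>, so no slicing of the space along
  \<open>e\<close> is needed.\<close>

lemma nn_integral_radial_half_tail:
  fixes e :: "'a::euclidean_space" and g :: "'a \<Rightarrow> ennreal"
  assumes e: "e \<in> Basis"
    and f [measurable]: "f \<in> borel_measurable borel"
    and g [measurable]: "g \<in> borel_measurable borel"
  shows "(\<integral>\<^sup>+y. g y \<partial>radial (half_tail f)) =
    (\<integral>\<^sup>+y. (\<integral>\<^sup>+\<tau>. g (squeeze e (1 / sqrt \<tau>) y) *
        ennreal ((y \<bullet> e)\<^sup>2 * (1 / (2 * \<tau> * sqrt \<tau>))) * indicator {1..} \<tau> \<partial>lborel) \<partial>radial f)"
proof -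
  define K where "K y \<tau> = g y * ennreal ((y \<bullet> e)\<^sup>2 / 2) * f (y \<bullet> y - (y \<bullet> e)\<^sup>2 + (y \<bullet> e)\<^sup>2 * \<tau>)
     * indicator {1..} \<tau>" for y \<tau>
  have [measurable]: "case_prod K \<in> borel_measurable (borel \<Otimes>\<^sub>M borel)"
    unfolding K_def by measurable
  have [measurable]: "case_prod K \<in> borel_measurable borel"
    by (simp add: borel_prod[symmetric])
  have "(\<integral>\<^sup>+y. g y \<partial>radial (half_tail f)) = (\<integral>\<^sup>+y. half_tail f (y \<bullet> y) * g y \<partial>lborel)"
    by (rule nn_integral_radial) auto
  also have "\<dots> = (\<integral>\<^sup>+y. (\<integral>\<^sup>+\<tau>. K y \<tau> \<partial>lborel) \<partial>lborel)"
  \<comment> \<open>\<open>half_tail_affine\<close> needs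
    \<open>(y \<bullet> e)\<^sup>2 > 0\<close>, which fails only on a hyperplane.\<close>
  proof (rule nn_integral_cong_AE, use AE_lborel_inner_neq_0[OF e] in eventually_elim)
    case (elim y)
    have "half_tail f (y \<bullet> y) = ennreal ((y \<bullet> e)\<^sup>2 / 2) *
        (\<integral>\<^sup>+\<tau>. f (y \<bullet> y - (y \<bullet> e)\<^sup>2 + (y \<bullet> e)\<^sup>2 * \<tau>) * indicator {1..} \<tau> \<partial>lborel)"
      using elim half_tail_affine[OF f, of "(y \<bullet> e)\<^sup>2" "y \<bullet> y - (y \<bullet> e)\<^sup>2"] by simp
    then show ?case
      by (simp add: K_def nn_integral_cmult[symmetric] mult.assoc mult.commute[of _ "g y"])
  qed
  also have "\<dots> = (\<integral>\<^sup>+\<tau>. (\<integral>\<^sup>+y. K y \<tau> \<partial>lborel) \<partial>lborel)"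
    by (rule lborel_pair.Fubini') simp
  also have "\<dots> = (\<integral>\<^sup>+\<tau>. (\<integral>\<^sup>+y. f (y \<bullet> y) * (g (squeeze e (1 / sqrt \<tau>) y) *
        ennreal ((y \<bullet> e)\<^sup>2 * (1 / (2 * \<tau> * sqrt \<tau>))) * indicator {1..} \<tau>) \<partial>lborel) \<partial>lborel)"
  proof (rule nn_integral_cong)
    fix \<tau> :: real
    show "(\<integral>\<^sup>+y. K y \<tau> \<partial>lborel) = (\<integral>\<^sup>+y. f (y \<bullet> y) * (g (squeeze e (1 / sqrt \<tau>) y) *
        ennreal ((y \<bullet> e)\<^sup>2 * (1 / (2 * \<tau> * sqrt \<tau>))) * indicator {1..} \<tau>) \<partial>lborel)"
    proof (cases "1 \<le> \<tau>")
      case False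
      then show ?thesis by (simp add: K_def)
    next
      case True
      \<comment> \<open>With \<open>r\<^sup>2 * \<tau> = 1\<close> the argument of \<open>f\<close>
        collapses to \<open>y \<bullet> y\<close>. The power \<open>r * r\<^sup>2\<close> collects
        the Jacobian \<open>r\<close> and the scaling of
        \<open>(y \<bullet> e)\<^sup>2\<close>.\<close>
      define r where "r = 1 / sqrt \<tau>"
      have r: "r > 0" "r\<^sup>2 * \<tau> = 1" "r * r\<^sup>2 = 1 / (\<tau> * sqrt \<tau>)"
        using True by (auto simp: r_def power2_eq_square field_simps)
      have "(\<integral>\<^sup>+y. K y \<tau> \<partial>lborel) = ennreal \<bar>r\<bar> * (\<integral>\<^sup>+y. K (squeeze e r y) \<tau> \<partial>lborel)"
        unfolding squeeze_def using r
        by (intro nn_integral_scale_direction[OF e]) (auto simp: K_def)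
      also have "\<dots> = (\<integral>\<^sup>+y. ennreal \<bar>r\<bar> * K (squeeze e r y) \<tau> \<partial>lborel)"
        by (intro nn_integral_cmult[symmetric]) (auto simp: K_def)
      also have "\<dots> = (\<integral>\<^sup>+y. f (y \<bullet> y) * (g (squeeze e r y) *
          ennreal ((y \<bullet> e)\<^sup>2 * (1 / (2 * \<tau> * sqrt \<tau>))) * indicator {1..} \<tau>) \<partial>lborel)"
      proof (rule nn_integral_cong)
        fix y
        have *: "y \<bullet> y + (r\<^sup>2 - 1) * (y \<bullet> e)\<^sup>2 - (r * (y \<bullet> e))\<^sup>2 + (r * (y \<bullet> e))\<^sup>2 * \<tau>
          = y \<bullet> y + (r\<^sup>2 * \<tau> - 1) * (y \<bullet> e)\<^sup>2"
          by (simp add: power2_eq_square algebra_simps)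
        have "ennreal \<bar>r\<bar> * ennreal ((r * (y \<bullet> e))\<^sup>2 / 2) = ennreal ((r * r\<^sup>2) * (y \<bullet> e)\<^sup>2 / 2)"
          using r(1) by (simp add: ennreal_mult[symmetric] power_mult_distrib ac_simps)
        also have "(r * r\<^sup>2) * (y \<bullet> e)\<^sup>2 / 2 = (y \<bullet> e)\<^sup>2 * (1 / (2 * \<tau> * sqrt \<tau>))"
          unfolding r by simp
        finally have **: "ennreal \<bar>r\<bar> * ennreal ((r * (y \<bullet> e))\<^sup>2 / 2) =
          ennreal ((y \<bullet> e)\<^sup>2 * (1 / (2 * \<tau> * sqrt \<tau>)))" .
        have "K (squeeze e r y) \<tau> = g (squeeze e r y) * ennreal ((r * (y \<bullet> e))\<^sup>2 / 2) * f (y \<bullet> y)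
           * indicator {1..} \<tau>"
          unfolding K_def squeeze_inner[OF e] squeeze_inner_self[OF e] * r(2) by simp
        then show "ennreal \<bar>r\<bar> * K (squeeze e r y) \<tau> = f (y \<bullet> y) * (g (squeeze e r y) *
          ennreal ((y \<bullet> e)\<^sup>2 * (1 / (2 * \<tau> * sqrt \<tau>))) * indicator {1..} \<tau>)"
          unfolding **[symmetric] by (simp only: ac_simps)
      qed
      finally show ?thesis by (simp add: r_def)
    qed
  qed
  also have "\<dots> = (\<integral>\<^sup>+y. (\<integral>\<^sup>+\<tau>. f (y \<bullet> y) * (g (squeeze e (1 / sqrt \<tau>) y) *
        ennreal ((y \<bullet> e)\<^sup>2 * (1 / (2 * \<tau> * sqrt \<tau>))) * indicator {1..} \<tau>) \<partial>lborel) \<partial>lborel)"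
    by (rule lborel_pair.Fubini') simp
  also have "\<dots> = (\<integral>\<^sup>+y. f (y \<bullet> y) * (\<integral>\<^sup>+\<tau>. (g (squeeze e (1 / sqrt \<tau>) y) *
        ennreal ((y \<bullet> e)\<^sup>2 * (1 / (2 * \<tau> * sqrt \<tau>))) * indicator {1..} \<tau>) \<partial>lborel) \<partial>lborel)"
    by (simp add: nn_integral_cmult)
  finally show ?thesis
    by (subst nn_integral_radial) auto
qed

section \<open>Integration by parts along one coordinate\<close>

lemma squeeze_one [simp]: "squeeze e 1 y = y"
  by (simp add: squeeze_def)

lemma squeeze_squeeze:
  assumes "e \<in> Basis"
  shows "squeeze e r (squeeze e s y) = squeeze e (r * s) y"
proof -
  have "(s - 1) * (y \<bullet> e) + (r - 1) * (s * (y \<bullet> e)) = (r * s - 1) * (y \<bullet> e)"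
    by (simp add: algebra_simps)
  then show ?thesis
    unfolding squeeze_def[of e r] squeeze_inner[OF assms]
    unfolding squeeze_def add.assoc scaleR_left_distrib[symmetric] by simp
qed

lemma DERIV_squeeze:
  fixes h g :: "'a::euclidean_space \<Rightarrow> real"
  assumes deriv: "\<And>y. ((\<lambda>t. h (y + t *\<^sub>R e)) has_real_derivative g y) (at 0)"
  shows "((\<lambda>r. h (squeeze e r y)) has_real_derivative g (squeeze e r y) * (y \<bullet> e)) (at r)"
proof -
  have "((\<lambda>s. h (squeeze e r y + ((s - r) * (y \<bullet> e)) *\<^sub>R e)) has_real_derivative
      g (squeeze e r y) * (y \<bullet> e)) (at r)"
    by (rule DERIV_chain2[where g = "\<lambda>s. (s - r) * (y \<bullet> e)" and
          f = "\<lambda>t. h (squeeze e r y + t *\<^sub>R e)"])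
      (use deriv in \<open>auto intro!: derivative_eq_intros\<close>)
  also have "(\<lambda>s. h (squeeze e r y + ((s - r) * (y \<bullet> e)) *\<^sub>R e)) = (\<lambda>s. h (squeeze e s y))"
    by (simp add: squeeze_def algebra_simps)
  finally show ?thesis .
qed

text \<open>The integrand is the \<tau>-derivative of
  \<open>- (y \<bullet> e) * h (squeeze e (1 / sqrt \<tau>) y)\<close>. At \<tau> = 1 the point is
  \<open>y\<close>, and as \<tau> tends to infinity it tends to the projection of \<open>y\<close>,
  which gives the two boundary terms.\<close>

lemma nn_integral_deriv_squeeze:
  fixes h g :: "'a::euclidean_space \<Rightarrow> real"
  assumes deriv: "\<And>y. ((\<lambda>t. h (y + t *\<^sub>R e)) has_real_derivative g y) (at 0)"
    and g [measurable]: "g \<in> borel_measurable borel" and g_nonneg: "\<And>y. 0 \<le> g y"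
  shows "(\<integral>\<^sup>+\<tau>. ennreal (g (squeeze e (1 / sqrt \<tau>) y)) *
      ennreal ((y \<bullet> e)\<^sup>2 * (1 / (2 * \<tau> * sqrt \<tau>))) * indicator {1..} \<tau> \<partial>lborel) =
    ennreal ((y \<bullet> e) * (h y - h (squeeze e 0 y)))"
proof -
  define q where "q \<tau> = g (squeeze e (1 / sqrt \<tau>) y) * ((y \<bullet> e)\<^sup>2 * (1 / (2 * \<tau> * sqrt \<tau>)))" for \<tau>
  define Q where "Q \<tau> = - (y \<bullet> e) * h (squeeze e (1 / sqrt \<tau>) y)" for \<tau>
  have "(\<integral>\<^sup>+\<tau>. ennreal (q \<tau>) * indicator {1..} \<tau> \<partial>lborel) =
      - (y \<bullet> e) * h (squeeze e 0 y) - Q 1"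
  proof (rule nn_integral_FTC_atLeast)
    show "q \<in> borel_measurable borel"
      unfolding q_def by measurable
    show "(Q has_real_derivative q \<tau>) (at \<tau>)" if "1 \<le> \<tau>" for \<tau>
    proof -
      have "((\<lambda>\<tau>. 1 / sqrt \<tau>) has_real_derivative - 1 / (2 * \<tau> * sqrt \<tau>)) (at \<tau>)"
        using that by (auto intro!: derivative_eq_intros simp: field_simps)
      from DERIV_chain2[OF DERIV_squeeze[of h e g y, OF deriv] this]
      have "((\<lambda>\<tau>. h (squeeze e (1 / sqrt \<tau>) y)) has_real_derivative
          g (squeeze e (1 / sqrt \<tau>) y) * (y \<bullet> e) * (- 1 / (2 * \<tau> * sqrt \<tau>))) (at \<tau>)" .
      from DERIV_cmult[OF this, of "- (y \<bullet> e)"] show ?thesis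
        by (simp add: Q_def[abs_def] q_def power2_eq_square ac_simps)
    qed
    show "0 \<le> q \<tau>" if "1 \<le> \<tau>" for \<tau>
      using that g_nonneg by (auto simp: q_def intro!: mult_nonneg_nonneg)
    have "((\<lambda>\<tau>. 1 / sqrt \<tau>) \<longlongrightarrow> 0) at_top"
      by (intro tendsto_divide_0[OF tendsto_const] filterlim_at_top_imp_at_infinity sqrt_at_top)
    from isCont_tendsto_compose[OF DERIV_isCont[OF DERIV_squeeze[of h e g y 0, OF deriv]] this]
    show "(Q \<longlongrightarrow> - (y \<bullet> e) * h (squeeze e 0 y)) at_top"
      unfolding Q_def[abs_def] by (intro tendsto_mult tendsto_const)
  qed
  also have "- (y \<bullet> e) * h (squeeze e 0 y) - Q 1 = (y \<bullet> e) * (h y - h (squeeze e 0 y))"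
    by (simp add: Q_def algebra_simps)
  also have "(\<lambda>\<tau>. ennreal (q \<tau>)) = (\<lambda>\<tau>. ennreal (g (squeeze e (1 / sqrt \<tau>) y)) *
      ennreal ((y \<bullet> e)\<^sup>2 * (1 / (2 * \<tau> * sqrt \<tau>))))"
    unfolding q_def by (rule ext) (rule ennreal_mult'[OF g_nonneg])
  finally show ?thesis .
qed

text \<open>The term \<open>(y \<bullet> e) * h (squeeze e 0 y)\<close> is odd in the
  \<open>e\<close>-coordinate. Keeping it under the integral makes the integrand nonnegative, so the
  identity holds in the extended reals, whether or not the integrals are finite.\<close>

lemma stein_nonneg:
  fixes h g :: "'a::euclidean_space \<Rightarrow> real"
  assumes e: "e \<in> Basis" and f: "f \<in> borel_measurable borel"
    and deriv: "\<And>y. ((\<lambda>t. h (y + t *\<^sub>R e)) has_real_derivative g y) (at 0)"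
    and g: "g \<in> borel_measurable borel" "\<And>y. 0 \<le> g y"
  shows "(\<integral>\<^sup>+y. ennreal (g y) \<partial>radial (half_tail f)) =
    (\<integral>\<^sup>+y. ennreal ((y \<bullet> e) * (h y - h (squeeze e 0 y))) \<partial>radial f)"
proof -
  have "(\<lambda>y. ennreal (g y)) \<in> borel_measurable borel"
    using g by simp
  from nn_integral_radial_half_tail[OF e f this] show ?thesis
    by (simp only: nn_integral_deriv_squeeze[OF deriv g])
qed

text \<open>Along \<open>r\<close> the function \<open>(y \<bullet> e) * h (squeeze e r y)\<close>
  has derivative g times \<open>(y \<bullet> e)\<^sup>2\<close>, so it increases from r = 0 to r = 1
  for either sign of \<open>y \<bullet> e\<close>.\<close>

lemma deriv_squeeze_nonneg:
  fixes h g :: "'a::euclidean_space \<Rightarrow> real"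
  assumes deriv: "\<And>y. ((\<lambda>t. h (y + t *\<^sub>R e)) has_real_derivative g y) (at 0)"
    and g: "\<And>y. 0 \<le> g y"
  shows "0 \<le> (y \<bullet> e) * (h y - h (squeeze e 0 y))"
proof -
  have "(y \<bullet> e) * h (squeeze e 0 y) \<le> (y \<bullet> e) * h (squeeze e 1 y)"
  proof (rule DERIV_nonneg_imp_nondecreasing[where f = "\<lambda>r. (y \<bullet> e) * h (squeeze e r y)"])
    fix r :: real
    have "((\<lambda>r. (y \<bullet> e) * h (squeeze e r y)) has_real_derivative
        (y \<bullet> e) * (g (squeeze e r y) * (y \<bullet> e))) (at r)"
      by (rule DERIV_cmult[OF DERIV_squeeze[of h e g, OF deriv]])
    moreover have "0 \<le> (y \<bullet> e) * (g (squeeze e r y) * (y \<bullet> e))"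
    proof -
      have "0 \<le> g (squeeze e r y) * (y \<bullet> e)\<^sup>2"
        using g by simp
      then show ?thesis by (simp add: power2_eq_square ac_simps)
    qed
    ultimately show "\<exists>y'. ((\<lambda>r. (y \<bullet> e) * h (squeeze e r y)) has_real_derivative y') (at r) \<and> 0 \<le> y'"
      by blast
  qed simp
  then show ?thesis by (simp add: algebra_simps)
qed

lemma has_real_derivative_inner_Basis:
  assumes "e \<in> Basis"
  shows "((\<lambda>t. (y + t *\<^sub>R e) \<bullet> e) has_real_derivative 1) (at 0)"
proof -
  have "(\<lambda>t. (y + t *\<^sub>R e) \<bullet> e) = (\<lambda>t. y \<bullet> e + t)"
    using assms by (simp add: inner_simps)
  then show ?thesis
    by (auto intro!: derivative_eq_intros)
qed

text \<open>\<open>stein_nonneg\<close> applied to the coordinate itself. The left side does not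
  depend on \<open>e\<close>: all coordinates have the same second moment, and a finite one makes
  the tail measure finite.\<close>

lemma emeasure_radial_half_tail:
  fixes e :: "'a::euclidean_space"
  assumes e: "e \<in> Basis" and f: "f \<in> borel_measurable borel"
  shows "emeasure (radial (half_tail f)) (UNIV :: 'a set) = (\<integral>\<^sup>+y. ennreal ((y \<bullet> e)\<^sup>2) \<partial>radial f)"
proof -
  have "(\<integral>\<^sup>+(y::'a). ennreal 1 \<partial>radial (half_tail f)) =
      (\<integral>\<^sup>+y. ennreal ((y \<bullet> e) * (y \<bullet> e - squeeze e 0 y \<bullet> e)) \<partial>radial f)"
  proof (rule stein_nonneg[where h = "\<lambda>y. y \<bullet> e" and g = "\<lambda>_. 1", OF e f])
    fix y
    show "((\<lambda>t. (y + t *\<^sub>R e) \<bullet> e) has_real_derivative 1) (at 0)"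
      by (rule has_real_derivative_inner_Basis[OF e])
  qed auto
  then show ?thesis
    by (simp add: squeeze_inner[OF e] power2_eq_square)
qed

lemma distr_radial_reflect:
  fixes e :: "'a::euclidean_space"
  assumes e: "e \<in> Basis" and f [measurable]: "f \<in> borel_measurable borel"
  shows "distr (radial f) borel (squeeze e (- 1)) = radial f"
proof (rule measure_eqI)
  fix A assume "A \<in> sets (distr (radial f) borel (squeeze e (- 1)))"
  then have [measurable]: "A \<in> sets borel" by simp
  have "emeasure (distr (radial f) borel (squeeze e (- 1))) A =
      (\<integral>\<^sup>+y. indicator A y \<partial>distr (radial f) borel (squeeze e (- 1)))"
    by simp
  also have "\<dots> = (\<integral>\<^sup>+y. indicator A (squeeze e (- 1) y) \<partial>radial f)"
    by (rule nn_integral_distr) auto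
  also have "\<dots> = (\<integral>\<^sup>+y. f (y \<bullet> y) * indicator A (squeeze e (- 1) y) \<partial>lborel)"
    by (rule nn_integral_radial) auto
  also have "\<dots> = (\<integral>\<^sup>+y. f (squeeze e (- 1) y \<bullet> squeeze e (- 1) y) * indicator A (squeeze e (- 1) y) \<partial>lborel)"
    by (simp add: squeeze_inner_self[OF e])
  also have "\<dots> = (\<integral>\<^sup>+y. f (y \<bullet> y) * indicator A y \<partial>lborel)"
    using nn_integral_scale_direction[OF e, of "- 1" "\<lambda>y. f (y \<bullet> y) * indicator A y"]
    by (simp add: squeeze_def)
  also have "\<dots> = (\<integral>\<^sup>+y. indicator A y \<partial>radial f)"
    by (rule nn_integral_radial[symmetric]) auto
  finally show "emeasure (distr (radial f) borel (squeeze e (- 1))) A = emeasure (radial f) A"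
    by simp
qed simp

text \<open>The reflection preserves the measure, fixes \<open>squeeze e 0 y\<close> and negates
  \<open>y \<bullet> e\<close>, so the integral equals its own negative. For a non-integrable
  integrand the value is 0 by convention.\<close>

lemma integral_radial_odd:
  fixes e :: "'a::euclidean_space" and h :: "'a \<Rightarrow> real"
  assumes e: "e \<in> Basis" and f: "f \<in> borel_measurable borel"
    and [measurable]: "h \<in> borel_measurable borel"
  shows "(\<integral>y. (y \<bullet> e) * h (squeeze e 0 y) \<partial>radial f) = 0"
proof -
  have "(\<integral>y. (y \<bullet> e) * h (squeeze e 0 y) \<partial>radial f) =
      (\<integral>y. (y \<bullet> e) * h (squeeze e 0 y) \<partial>distr (radial f) borel (squeeze e (- 1)))"
    by (simp add: distr_radial_reflect[OF e f])
  also have "\<dots> = (\<integral>y. - ((y \<bullet> e) * h (squeeze e 0 y)) \<partial>radial f)"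
    by (subst integral_distr) (auto simp: squeeze_inner[OF e] squeeze_squeeze[OF e])
  finally show ?thesis by simp
qed

text \<open>Adding \<open>M * (y \<bullet> e)\<close> to \<open>h\<close> makes the derivative
  \<open>g + M\<close> nonnegative, so \<open>stein_nonneg\<close> applies. The added term
  contributes M times the mass of the tail measure to both sides and cancels, and the projected term
  integrates to zero by oddness.\<close>

proposition stein_identity:
  fixes h g :: "'a::euclidean_space \<Rightarrow> real"
  assumes e: "e \<in> Basis" and f: "f \<in> borel_measurable borel"
    and fin: "emeasure (radial (half_tail f)) (UNIV :: 'a set) < \<infinity>"
    and h [measurable]: "h \<in> borel_measurable borel"
    and deriv: "\<And>y. ((\<lambda>t. h (y + t *\<^sub>R e)) has_real_derivative g y) (at 0)"
    and g [measurable]: "g \<in> borel_measurable borel" and g_bound: "\<And>y. \<bar>g y\<bar> \<le> M"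
    and int: "integrable (radial f) (\<lambda>y. (y \<bullet> e) * h y)"
  shows "integrable (radial (half_tail f)) g"
    and "(\<integral>y. g y \<partial>radial (half_tail f)) = (\<integral>y. (y \<bullet> e) * h y \<partial>radial f)"
proof -
  let ?\<nu> = "radial (half_tail f) :: 'a measure"
  interpret finite_measure ?\<nu>
    using fin by (intro finite_measureI) auto
  define u where "u y = (y \<bullet> e) * (h y + M * (y \<bullet> e) - h (squeeze e 0 y))" for y
  show g_int: "integrable ?\<nu> g"
    using g_bound by (intro integrable_const_bound[of _ M]) auto
  have sq_int: "integrable (radial f) (\<lambda>y. (y \<bullet> e)\<^sup>2)"
    using fin emeasure_radial_half_tail[OF e f] by (intro integrableI_nonneg) auto
  have sq: "(\<integral>y. (y \<bullet> e)\<^sup>2 \<partial>radial f) = measure ?\<nu> UNIV"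
    using emeasure_radial_half_tail[OF e f]
    by (subst integral_eq_nn_integral) (auto simp: measure_def)
  have M_deriv: "((\<lambda>t. h (y + t *\<^sub>R e) + M * ((y + t *\<^sub>R e) \<bullet> e)) has_real_derivative g y + M) (at 0)" for y
    using DERIV_add[OF deriv DERIV_cmult[OF has_real_derivative_inner_Basis[OF e], of M]] by simp
  have gM: "0 \<le> g y + M" for y
    using g_bound[of y] by linarith
  have u_nonneg: "0 \<le> u y" for y
    using deriv_squeeze_nonneg[of "\<lambda>y. h y + M * (y \<bullet> e)" e, OF M_deriv gM, of y]
    by (simp add: u_def squeeze_inner[OF e])
  have "(\<integral>\<^sup>+y. ennreal (g y + M) \<partial>?\<nu>) = (\<integral>\<^sup>+y. ennreal (u y) \<partial>radial f)"
    using stein_nonneg[of e f "\<lambda>y. h y + M * (y \<bullet> e)", OF e f M_deriv] gM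
    by (simp add: u_def squeeze_inner[OF e])
  moreover have gM_int: "integrable ?\<nu> (\<lambda>y. g y + M)"
    using g_int by simp
  ultimately have u_nn: "(\<integral>\<^sup>+y. ennreal (u y) \<partial>radial f) = ennreal (\<integral>y. g y + M \<partial>?\<nu>)"
    using gM by (subst (asm) nn_integral_eq_integral) auto
  have [measurable]: "u \<in> borel_measurable borel"
    unfolding u_def by measurable
  have u_int: "integrable (radial f) u"
    using u_nn u_nonneg by (intro integrableI_nonneg) auto
  have u_eq: "(\<integral>y. u y \<partial>radial f) = (\<integral>y. g y + M \<partial>?\<nu>)"
    using u_nn u_nonneg gM by (subst integral_eq_nn_integral) (auto intro!: enn2real_ennreal integral_nonneg_AE)
  \<comment> \<open>Solving for the odd term expresses it through three integrable functions, so its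
    vanishing integral splits into theirs.\<close>
  have k: "(y \<bullet> e) * h (squeeze e 0 y) = (y \<bullet> e) * h y + M * (y \<bullet> e)\<^sup>2 - u y" for y
    by (simp add: u_def algebra_simps power2_eq_square)
  have "0 = (\<integral>y. (y \<bullet> e) * h (squeeze e 0 y) \<partial>radial f)"
    by (rule integral_radial_odd[OF e f h, symmetric])
  also have "\<dots> = (\<integral>y. (y \<bullet> e) * h y \<partial>radial f) + M * measure ?\<nu> UNIV - (\<integral>y. g y + M \<partial>?\<nu>)"
    unfolding k using int sq_int u_int by (simp add: sq u_eq)
  also have "(\<integral>y. g y + M \<partial>?\<nu>) = (\<integral>y. g y \<partial>?\<nu>) + M * measure ?\<nu> UNIV"
    using g_int by (subst Bochner_Integration.integral_add) auto
  finally show "(\<integral>y. g y \<partial>?\<nu>) = (\<integral>y. (y \<bullet> e) * h y \<partial>radial f)"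
    by simp
qed

subsection \<open>Lower bound for the maximal risk in a location family\<close>

lemma nn_integral_lborel_translate:
  fixes g :: "'a::euclidean_space \<Rightarrow> ennreal"
  assumes "g \<in> borel_measurable borel"
  shows "(\<integral>\<^sup>+y. g (t + y) \<partial>lborel) = (\<integral>\<^sup>+y. g y \<partial>lborel)"
  using nn_integral_lborel_affine[of "\<lambda>_. 1" g t] assms by (simp add: euclidean_representation)

lemma nn_integral_lborel_reflect:
  fixes g :: "'a::euclidean_space \<Rightarrow> ennreal"
  assumes "g \<in> borel_measurable borel"
  shows "(\<integral>\<^sup>+y. g (- y) \<partial>lborel) = (\<integral>\<^sup>+y. g y \<partial>lborel)"
  using nn_integral_lborel_affine[of "\<lambda>_. - 1" g 0] assms
  by (simp add: euclidean_representation sum_negf)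

definition cube :: "real \<Rightarrow> 'a::euclidean_space set" where
  "cube r = cbox (- r *\<^sub>R One) (r *\<^sub>R One)"

lemma mem_cube: "x \<in> cube r \<longleftrightarrow> (\<forall>b\<in>Basis. \<bar>x \<bullet> b\<bar> \<le> r)"
  by (auto simp: cube_def mem_box abs_le_iff minus_le_iff)

lemma cube_sets [measurable]: "cube r \<in> sets borel"
  by (simp add: cube_def)

lemma emeasure_cube:
  assumes "0 \<le> r"
  shows "emeasure lborel (cube r :: 'a::euclidean_space set) = ennreal ((2 * r) ^ DIM('a))"
  using assms by (simp add: cube_def emeasure_lborel_cbox_eq inner_simps prod_constant)

lemma uminus_mem_cube [simp]: "- x \<in> cube r \<longleftrightarrow> x \<in> cube r"
  by (simp add: mem_cube)

lemma add_mem_cube: "x \<in> cube r \<Longrightarrow> y \<in> cube s \<Longrightarrow> x + y \<in> cube (r + s)"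
  by (fastforce simp: mem_cube inner_simps)

text \<open>Cube and kernel are even, so u may be replaced by -u on the right; twice the right side
  then integrates Q(e + u) + Q(e - u). The hypothesis on \<open>Q\<close> holds for every even
  convex function, since u is the midpoint of e + u and -(e - u).\<close>

lemma nn_integral_cube_centered_le:
  fixes Q \<rho> :: "'a::euclidean_space \<Rightarrow> ennreal"
  assumes [measurable]: "Q \<in> borel_measurable borel" "\<rho> \<in> borel_measurable borel"
    and even: "\<And>u. \<rho> (- u) = \<rho> u"
    and Q: "\<And>e u. 2 * Q u \<le> Q (e + u) + Q (e - u)"
  shows "(\<integral>\<^sup>+u. indicator (cube a) u * (Q u * \<rho> u) \<partial>lborel)
    \<le> (\<integral>\<^sup>+u. indicator (cube a) u * (Q (e - u) * \<rho> u) \<partial>lborel)" (is "?I \<le> ?J")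
proof -
  have J: "?J = (\<integral>\<^sup>+u. indicator (cube a) u * (Q (e + u) * \<rho> u) \<partial>lborel)"
    using nn_integral_lborel_reflect[of "\<lambda>u. indicator (cube a) u * (Q (e - u) * \<rho> u)"]
    by (simp add: even indicator_def)
  have "2 * ?I = (\<integral>\<^sup>+u. indicator (cube a) u * (2 * Q u * \<rho> u) \<partial>lborel)"
    by (simp add: nn_integral_cmult[symmetric] ac_simps)
  also have "\<dots> \<le> (\<integral>\<^sup>+u. indicator (cube a) u * ((Q (e + u) + Q (e - u)) * \<rho> u) \<partial>lborel)"
    by (intro nn_integral_mono mult_left_mono mult_right_mono Q) auto
  also have "\<dots> = ?J + ?J"
    by (subst (1) J) (simp add: nn_integral_add[symmetric] distrib_left distrib_right)
  finally have "2 * ?I \<le> 2 * ?J"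
    by (simp add: mult_2)
  then show ?thesis
    by (simp add: ennreal_mult_le_mult_iff)
qed

text \<open>Girshick--Savage: average the risk over a uniform prior on a large cube. Since the kernel is
  even, symmetrizing in \<open>u\<close> removes the estimator from the inner integral.\<close>

lemma location_lower_bound_cube:
  fixes \<delta> :: "'a::euclidean_space \<times> 'b::euclidean_space \<Rightarrow> 'a"
    and \<rho> :: "'a \<times> 'b \<Rightarrow> ennreal" and Q :: "'a \<Rightarrow> ennreal"
  assumes [measurable]: "\<delta> \<in> borel_measurable borel" "\<rho> \<in> borel_measurable borel"
      "Q \<in> borel_measurable borel"
    and even: "\<And>u z. \<rho> (- u, z) = \<rho> (u, z)"
    and Q: "\<And>e u. 2 * Q u \<le> Q (e + u) + Q (e - u)"
    and bound: "\<And>\<theta>. (\<integral>\<^sup>+y. Q (\<delta> y - \<theta>) * \<rho> (fst y - \<theta>, snd y) \<partial>lborel) \<le> M"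
    and a: "0 \<le> a" "0 \<le> r"
  shows "ennreal ((2 * r) ^ DIM('a)) *
      (\<integral>\<^sup>+z. (\<integral>\<^sup>+u. indicator (cube a) u * (Q u * \<rho> (u, z)) \<partial>lborel) \<partial>lborel)
    \<le> M * ennreal ((2 * (r + a)) ^ DIM('a))"
proof -
  have [measurable]: "\<delta> \<in> borel_measurable (borel \<Otimes>\<^sub>M borel)" "\<rho> \<in> borel_measurable (borel \<Otimes>\<^sub>M borel)"
    by (simp_all add: borel_prod)
  have [measurable]: "fst \<in> borel_measurable (borel :: ('a \<times> 'b) measure)"
      "snd \<in> borel_measurable (borel :: ('a \<times> 'b) measure)"
    by (simp_all add: borel_prod[symmetric])
  have "ennreal ((2 * r) ^ DIM('a)) *
      (\<integral>\<^sup>+z. (\<integral>\<^sup>+u. indicator (cube a) u * (Q u * \<rho> (u, z)) \<partial>lborel) \<partial>lborel) =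
    (\<integral>\<^sup>+x. indicator (cube r) (x::'a) * (\<integral>\<^sup>+z. (\<integral>\<^sup>+u. indicator (cube a) u * (Q u * \<rho> (u, z)) \<partial>lborel) \<partial>lborel) \<partial>lborel)"
    using a by (simp add: nn_integral_multc emeasure_cube)
  also have "\<dots> = (\<integral>\<^sup>+x. (\<integral>\<^sup>+z. indicator (cube r) (x::'a) *
      (\<integral>\<^sup>+u. indicator (cube a) u * (Q u * \<rho> (u, z)) \<partial>lborel) \<partial>lborel) \<partial>lborel)"
    by (simp add: nn_integral_cmult)
  \<comment> \<open>For fixed \<open>(x, z)\<close> this is the centring lemma with e =
    \<open>\<delta> (x, z) - x\<close>.\<close>
  also have "\<dots> \<le> (\<integral>\<^sup>+x. (\<integral>\<^sup>+z. indicator (cube r) (x::'a) *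
      (\<integral>\<^sup>+u. indicator (cube a) u * (Q (\<delta> (x, z) - x - u) * \<rho> (u, z)) \<partial>lborel) \<partial>lborel) \<partial>lborel)"
    by (intro nn_integral_mono mult_left_mono nn_integral_cube_centered_le even Q) auto
  also have "\<dots> = (\<integral>\<^sup>+x. (\<integral>\<^sup>+z. (\<integral>\<^sup>+u. indicator (cube r) (x::'a) *
      (indicator (cube a) u * (Q (\<delta> (x, z) - x - u) * \<rho> (u, z))) \<partial>lborel) \<partial>lborel) \<partial>lborel)"
    by (simp add: nn_integral_cmult)
  \<comment> \<open>Now \<open>x + u\<close> becomes the parameter, and evenness turns
    \<open>\<rho> (u, z)\<close> into \<open>\<rho> (x - (x + u), z)\<close>. Trading both
    indicators for the one of \<open>cube (r + a)\<close> lets the observation \<open>x\<close>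
    range over the whole space, as in the risk.\<close>
  also have "\<dots> \<le> (\<integral>\<^sup>+x. (\<integral>\<^sup>+z. (\<integral>\<^sup>+u. indicator (cube (r + a)) (x + u) *
      (Q (\<delta> (x, z) - (x + u)) * \<rho> (x - (x + u), z)) \<partial>lborel) \<partial>lborel) \<partial>lborel)"
    by (intro nn_integral_mono)
      (auto simp: indicator_def even diff_diff_eq intro: add_mem_cube)
  also have "\<dots> = (\<integral>\<^sup>+x. (\<integral>\<^sup>+z. (\<integral>\<^sup>+\<theta>. indicator (cube (r + a)) \<theta> *
      (Q (\<delta> (x, z) - \<theta>) * \<rho> (x - \<theta>, z)) \<partial>lborel) \<partial>lborel) \<partial>lborel)"
    by (intro nn_integral_cong nn_integral_lborel_translate) measurable
  also have "\<dots> = (\<integral>\<^sup>+y. (\<integral>\<^sup>+\<theta>. indicator (cube (r + a)) \<theta> *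
      (Q (\<delta> y - \<theta>) * \<rho> (fst y - \<theta>, snd y)) \<partial>lborel) \<partial>(lborel \<Otimes>\<^sub>M lborel))"
    by (subst lborel.nn_integral_fst[symmetric]) (auto simp: borel_prod)
  also have "\<dots> = (\<integral>\<^sup>+\<theta>. (\<integral>\<^sup>+y. indicator (cube (r + a)) \<theta> *
      (Q (\<delta> y - \<theta>) * \<rho> (fst y - \<theta>, snd y)) \<partial>lborel) \<partial>lborel)"
    unfolding lborel_prod by (rule lborel_pair.Fubini') simp
  also have "\<dots> \<le> (\<integral>\<^sup>+\<theta>. M * indicator (cube (r + a)) (\<theta>::'a) \<partial>lborel)"
    using bound by (intro nn_integral_mono) (auto simp: indicator_def)
  also have "\<dots> = M * ennreal ((2 * (r + a)) ^ DIM('a))"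
    using a by (simp add: nn_integral_cmult emeasure_cube)
  finally show ?thesis .
qed

text \<open>For fixed \<open>a\<close> take r = a (k + 1): the volume ratio of the two cubes is ((k
  + 2) / (k + 1))^DIM, which tends to 1. This bounds the integral over \<open>cube a\<close>;
  letting \<open>a\<close> grow gives the whole space by monotone convergence.\<close>

proposition location_lower_bound:
  fixes \<delta> :: "'a::euclidean_space \<times> 'b::euclidean_space \<Rightarrow> 'a"
    and \<rho> :: "'a \<times> 'b \<Rightarrow> ennreal" and Q :: "'a \<Rightarrow> ennreal"
  assumes [measurable]: "\<delta> \<in> borel_measurable borel" "\<rho> \<in> borel_measurable borel"
      "Q \<in> borel_measurable borel"
    and even: "\<And>u z. \<rho> (- u, z) = \<rho> (u, z)"
    and Q: "\<And>e u. 2 * Q u \<le> Q (e + u) + Q (e - u)"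
    and bound: "\<And>\<theta>. (\<integral>\<^sup>+y. Q (\<delta> y - \<theta>) * \<rho> (fst y - \<theta>, snd y) \<partial>lborel) \<le> M"
  shows "(\<integral>\<^sup>+y. Q (fst y) * \<rho> y \<partial>lborel) \<le> M"
proof -
  have [measurable]: "\<rho> \<in> borel_measurable (borel \<Otimes>\<^sub>M borel)"
    by (simp_all add: borel_prod)
  define I where "I a = (\<integral>\<^sup>+z. (\<integral>\<^sup>+u. indicator (cube a) u * (Q u * \<rho> (u, z)) \<partial>lborel) \<partial>lborel)" for a
  have I_le: "I a \<le> M" if a: "0 < a" for a
  proof (rule tendsto_lowerbound)
    show "(\<lambda>k. M * ennreal (((real k + 2) / (real k + 1)) ^ DIM('a))) \<longlonglongrightarrow> M"
    proof (cases "M = \<top>")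
      case False
      have "(\<lambda>k. (real k + 2) / (real k + 1)) \<longlonglongrightarrow> 1"
        by real_asymp
      then have "(\<lambda>k. ((real k + 2) / (real k + 1)) ^ DIM('a)) \<longlonglongrightarrow> 1 ^ DIM('a)"
        by (rule tendsto_power)
      then have "(\<lambda>k. ennreal (((real k + 2) / (real k + 1)) ^ DIM('a))) \<longlonglongrightarrow> ennreal 1"
        by (intro tendsto_ennrealI) simp
      from ennreal_tendsto_cmult[OF _ this, of M] show ?thesis
        using False by (simp add: top.not_eq_extremum)
    next
      case True
      then show ?thesis
        by (simp add: ennreal_top_mult)
    qed
    show "\<forall>\<^sub>F k in sequentially. I a \<le> M * ennreal (((real k + 2) / (real k + 1)) ^ DIM('a))"
    proof (rule always_eventually, rule allI)
      fix k :: nat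
      define N where "N = (2 * (a * (real k + 1))) ^ DIM('a)"
      have N: "0 < N"
        using a by (simp add: N_def)
      have "ennreal N * I a \<le> M * ennreal ((2 * (a * (real k + 1) + a)) ^ DIM('a))"
        unfolding N_def I_def using a
        by (intro location_lower_bound_cube[where \<delta> = \<delta>] even Q bound) auto
      also have "(2 * (a * (real k + 1) + a)) ^ DIM('a) = N * ((real k + 2) / (real k + 1)) ^ DIM('a)"
        unfolding N_def power_mult_distrib[symmetric]
        by (rule arg_cong[where f = "\<lambda>x. x ^ DIM('a)"]) (simp add: field_simps)
      also have "M * ennreal \<dots> = ennreal N * (M * ennreal (((real k + 2) / (real k + 1)) ^ DIM('a)))"
        using N by (subst ennreal_mult') (simp_all add: mult.left_commute)
      finally show "I a \<le> M * ennreal (((real k + 2) / (real k + 1)) ^ DIM('a))"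
        using N by (simp add: ennreal_mult_le_mult_iff)
    qed
  qed simp
  have "(\<integral>\<^sup>+y. Q (fst y) * \<rho> y \<partial>lborel) = (\<integral>\<^sup>+z. (\<integral>\<^sup>+u. Q u * \<rho> (u, z) \<partial>lborel) \<partial>lborel)"
    by (subst lborel_prod[symmetric], subst lborel_pair.nn_integral_snd[symmetric]) auto
  also have "\<dots> = (\<integral>\<^sup>+z. (\<integral>\<^sup>+u. (SUP k. indicator (cube (real (Suc k))) u * (Q u * \<rho> (u, z))) \<partial>lborel) \<partial>lborel)"
  proof (intro nn_integral_cong)
    fix z :: 'b and u :: 'a
    obtain k :: nat where k: "infnorm u \<le> real k"
      using real_arch_simple by blast
    then have "u \<in> cube (real (Suc k))"
      by (auto simp: mem_cube intro: order_trans[OF Basis_le_infnorm])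
    then have "Q u * \<rho> (u, z) \<le> (SUP k. indicator (cube (real (Suc k))) u * (Q u * \<rho> (u, z)))"
      by (intro SUP_upper2[of k]) auto
    moreover have "(SUP k. indicator (cube (real (Suc k))) u * (Q u * \<rho> (u, z))) \<le> Q u * \<rho> (u, z)"
      by (intro SUP_least) (auto simp: indicator_def)
    ultimately show "Q u * \<rho> (u, z) = (SUP k. indicator (cube (real (Suc k))) u * (Q u * \<rho> (u, z)))"
      by (rule antisym)
  qed
  also have "\<dots> = (SUP k. I (real (Suc k)))"
  proof -
    have mono: "incseq (\<lambda>k. indicator (cube (real (Suc k))) u * (Q u * \<rho> (u, z)))" for u z
      by (auto simp: incseq_def indicator_def mem_cube intro: order_trans)
    show ?thesis
      unfolding I_def using mono
      by (subst nn_integral_monotone_convergence_SUP[symmetric])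
        (auto simp: incseq_def le_fun_def intro!: nn_integral_mono nn_integral_cong nn_integral_monotone_convergence_SUP)
  qed
  also have "\<dots> \<le> M"
    by (intro SUP_least I_le) simp
  finally show ?thesis .
qed

subsection \<open>Risk domination in canonical coordinates\<close>

lemma axis_fst_in_Basis: "(axis i 1, 0) \<in> (Basis :: ((real^'p) \<times> (real^'n::finite)) set)"
  by (simp add: Basis_prod_def)

lemma axis_snd_in_Basis: "(0, axis k 1) \<in> (Basis :: ((real^'p) \<times> (real^'n::finite)) set)"
  by (simp add: Basis_prod_def)

lemma Basis_prod_vec:
  "(Basis :: ((real^'p) \<times> (real^'n::finite)) set) =
    range (\<lambda>i. (axis i 1, 0)) \<union> range (\<lambda>k. (0, axis k 1))"
  by (auto simp: Basis_prod_def Basis_vec_def image_image)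

lemma inner_axis_fst: "(y :: (real^'p) \<times> (real^'n::finite)) \<bullet> (axis i 1, 0) = fst y $ i"
  by (simp add: inner_prod_def inner_axis)

lemma inner_axis_snd: "(y :: (real^'p) \<times> (real^'n::finite)) \<bullet> (0, axis k 1) = snd y $ k"
  by (simp add: inner_prod_def inner_axis)

lemma prod_Basis_prod_vec:
  fixes h :: "(real^'p) \<times> (real^'n::finite) \<Rightarrow> real"
  shows "prod h Basis = (\<Prod>i\<in>UNIV. h (axis i 1, 0)) * (\<Prod>k\<in>UNIV. h (0, axis k 1))"
proof -
  have "prod h Basis = prod h (range (\<lambda>i. (axis i 1, 0))) * prod h (range (\<lambda>k. (0, axis k 1)))"
    unfolding Basis_prod_vec by (rule prod.union_disjoint) (auto simp: axis_eq_0_iff)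
  also have "prod h (range (\<lambda>i. (axis i 1, 0))) = (\<Prod>i\<in>UNIV. h (axis i 1, 0))"
    by (subst prod.reindex) (auto simp: inj_on_def axis_eq_axis)
  also have "prod h (range (\<lambda>k. (0, axis k 1))) = (\<Prod>k\<in>UNIV. h (0, axis k 1))"
    by (subst prod.reindex) (auto simp: inj_on_def axis_eq_axis)
  finally show ?thesis .
qed

lemma borel_measurable_vec_lambda:
  fixes F :: "'p::finite \<Rightarrow> 'a \<Rightarrow> real"
  assumes "\<And>i. F i \<in> borel_measurable M"
  shows "(\<lambda>y. \<chi> i. F i y) \<in> borel_measurable M"
  using assms by (subst borel_measurable_euclidean_space) (auto simp: Basis_vec_def inner_axis)

lemma fst_nth_measurable [measurable]:
  "(\<lambda>y::(real^'p) \<times> (real^'n::finite). fst y $ i) \<in> borel_measurable borel"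
  by (intro borel_measurable_continuous_onI continuous_intros)

lemma snd_nth_measurable [measurable]:
  "(\<lambda>y::(real^'p) \<times> (real^'n::finite). snd y $ k) \<in> borel_measurable borel"
  by (intro borel_measurable_continuous_onI continuous_intros)

lemma snd_vec_measurable [measurable]:
  "snd \<in> borel_measurable (borel :: ((real^'p) \<times> (real^'n::finite)) measure)"
  by (intro borel_measurable_continuous_onI continuous_intros)

text \<open>Canonical coordinates: \<open>y = (u, v)\<close> with \<open>u = (x - \<theta>) / (\<sigma> \<surd>d)\<close>, \<open>v = z / \<sigma>\<close> and
  \<open>\<eta> = \<theta> / (\<sigma> \<surd>d)\<close>, so \<open>\<xi> = x / (\<sigma> \<surd>d)\<close>; the weights are \<open>\<omega> = d powr (1 - j)\<close> and
  \<open>g = \<gamma> (\<alpha> + 1)\<close>. Adding \<open>\<epsilon> > 0\<close> to the denominator makes the estimator smooth where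
  \<open>W\<close> degenerates.\<close>

locale shrinkage =
  fixes \<eta> \<omega> c :: "'p::finite \<Rightarrow> real" and \<alpha> g m \<epsilon> :: real
  assumes c_pos: "\<And>i. 0 < c i" and \<omega>_pos: "\<And>i. 0 < \<omega> i"
    and \<alpha>_pos: "0 < \<alpha>" and g_pos: "0 < g" and \<epsilon>_pos: "0 < \<epsilon>"
    and m_ge: "\<And>i. \<omega> i / c i \<le> m"
begin

definition \<xi> :: "'p \<Rightarrow> (real^'p) \<times> (real^'n::finite) \<Rightarrow> real" where
  "\<xi> i y = \<eta> i + fst y $ i"

definition S :: "(real^'p) \<times> (real^'n::finite) \<Rightarrow> real" where
  "S y = snd y \<bullet> snd y"

definition B :: "(real^'p) \<times> (real^'n::finite) \<Rightarrow> real" where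
  "B y = (\<Sum>i\<in>UNIV. (\<xi> i y)\<^sup>2 / c i)"

text \<open>The weighted square of the vector \<xi> / c along which the estimator shrinks, so that
  the quadratic part of the excess loss is \<open>(\<phi> y)\<^sup>2 * A y\<close>.\<close>

definition A :: "(real^'p) \<times> (real^'n::finite) \<Rightarrow> real" where
  "A y = (\<Sum>i\<in>UNIV. \<omega> i * (\<xi> i y)\<^sup>2 / (c i)\<^sup>2)"

definition P :: "(real^'p) \<times> (real^'n::finite) \<Rightarrow> real" where
  "P y = g * S y + B y + \<epsilon>"

text \<open>As W equals B / S in these coordinates, this is \<alpha> / (g + W) with the fraction
  expanded by S and \<epsilon> added below; the division by S, singular at z = 0, is gone.\<close>

definition \<phi> :: "(real^'p) \<times> (real^'n::finite) \<Rightarrow> real" where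
  "\<phi> y = \<alpha> * S y / P y"

text \<open>In canonical coordinates the excess loss is \<open>y \<bullet> V\<close> for the vector field
  \<open>V = (- 2 hx, hz)\<close>; \<open>gx\<close> and \<open>gz\<close> are the diagonal entries of the Jacobians of \<open>hx\<close>, \<open>hz\<close>.\<close>

definition hx :: "'p \<Rightarrow> (real^'p) \<times> (real^'n::finite) \<Rightarrow> real" where
  "hx i y = \<omega> i / c i * (\<phi> y * \<xi> i y)"

definition gx :: "'p \<Rightarrow> (real^'p) \<times> (real^'n::finite) \<Rightarrow> real" where
  "gx i y = \<omega> i / c i * (\<phi> y - 2 * \<alpha> * S y * ((\<xi> i y)\<^sup>2 / c i) / (P y)\<^sup>2)"

definition hz :: "'n \<Rightarrow> (real^'p) \<times> (real^'n::finite) \<Rightarrow> real" where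
  "hz k y = \<alpha>\<^sup>2 * (snd y $ k * S y * A y / (P y)\<^sup>2)"

definition gz :: "'n \<Rightarrow> (real^'p) \<times> (real^'n::finite) \<Rightarrow> real" where
  "gz k y = \<alpha>\<^sup>2 * A y * (S y / (P y)\<^sup>2 + 2 * (snd y $ k)\<^sup>2 / (P y)\<^sup>2
     - 4 * g * S y * (snd y $ k)\<^sup>2 / (P y) ^ 3)"

section \<open>Pointwise bounds and the sign of the divergence\<close>

lemma S_nonneg: "0 \<le> S y" by (simp add: S_def)
lemma B_nonneg: "0 \<le> B y" by (auto simp: B_def intro!: sum_nonneg divide_nonneg_pos c_pos)
lemma A_nonneg: "0 \<le> A y"
  unfolding A_def using \<omega>_pos by (intro sum_nonneg divide_nonneg_nonneg mult_nonneg_nonneg) (auto simp: less_imp_le)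
lemma P_pos: "0 < P y"
  unfolding P_def using S_nonneg[of y] B_nonneg[of y] g_pos \<epsilon>_pos
  by (intro add_nonneg_pos add_nonneg_nonneg mult_nonneg_nonneg) auto

lemma m_pos: "0 < m"
  using m_ge[of undefined] divide_pos_pos[OF \<omega>_pos c_pos, of undefined undefined] by linarith

lemma A_le_B: "A y \<le> m * B y"
  unfolding A_def B_def sum_distrib_left
proof (rule sum_mono)
  fix i
  have "\<omega> i / c i * ((\<xi> i y)\<^sup>2 / c i) \<le> m * ((\<xi> i y)\<^sup>2 / c i)"
    using c_pos[of i] by (intro mult_right_mono m_ge) simp
  then show "\<omega> i * (\<xi> i y)\<^sup>2 / (c i)\<^sup>2 \<le> m * ((\<xi> i y)\<^sup>2 / c i)"
    by (simp add: power2_eq_square)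
qed

lemma B_le_P: "B y \<le> P y"
  unfolding P_def using S_nonneg[of y] g_pos \<epsilon>_pos by simp

lemma A_div_P_le: "A y / P y \<le> m"
proof -
  have "A y \<le> m * P y"
    using A_le_B[of y] mult_left_mono[OF B_le_P, of m y] m_pos by linarith
  then show ?thesis using P_pos[of y] by (simp add: field_simps)
qed

lemma gS_div_P_le: "g * S y / P y \<le> 1"
proof -
  have "g * S y \<le> P y" unfolding P_def using B_nonneg[of y] \<epsilon>_pos by simp
  then show ?thesis using P_pos[of y] by simp
qed

lemma S_div_P_le: "S y / P y \<le> 1 / g"
  using gS_div_P_le[of y] g_pos P_pos[of y] by (simp add: field_simps)

lemma \<xi>_div_P_le: "(\<xi> i y)\<^sup>2 / c i / P y \<le> 1"
proof -
  have "(\<xi> i y)\<^sup>2 / c i \<le> B y"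
    unfolding B_def using c_pos by (intro member_le_sum) (auto simp: less_imp_le)
  then have "(\<xi> i y)\<^sup>2 / c i \<le> P y"
    using B_le_P[of y] by linarith
  then show ?thesis using P_pos[of y] by (simp only: pos_divide_le_eq mult_1)
qed

lemma S_eq: "S y = (\<Sum>k\<in>UNIV. (snd y $ k)\<^sup>2)"
  by (simp add: S_def inner_vec_def power2_eq_square)

lemma z_le_S: "(snd y $ k)\<^sup>2 \<le> S y"
  unfolding S_eq by (intro member_le_sum) auto

lemma z_div_P_le: "(snd y $ k)\<^sup>2 / P y \<le> 1 / g"
  using z_le_S[of y k] S_div_P_le[of y] P_pos[of y] divide_right_mono[of "(snd y $ k)\<^sup>2" "S y" "P y"]
  by linarith

lemma \<phi>_nonneg: "0 \<le> \<phi> y"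
  unfolding \<phi>_def using S_nonneg[of y] P_pos[of y] \<alpha>_pos by (simp add: less_imp_le)

lemma \<phi>_le: "\<phi> y \<le> \<alpha> / g"
  unfolding \<phi>_def using mult_left_mono[OF S_div_P_le, of \<alpha> y] \<alpha>_pos by simp

text \<open>Serves as the constant \<open>M\<close> of \<open>stein_identity\<close>, where any
  bound uniform in \<open>y\<close> will do. The 3 is the triangle inequality for \<phi> - 2 \<phi>
  q with 0 \<le> q \<le> 1.\<close>

lemma gx_bound: "\<bar>gx i y\<bar> \<le> \<omega> i / c i * (3 * (\<alpha> / g))"
proof -
  define q where "q = (\<xi> i y)\<^sup>2 / c i / P y"
  have q: "0 \<le> q" "q \<le> 1"
    using \<xi>_div_P_le[of i y] c_pos[of i] P_pos[of y] by (auto simp: q_def)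
  have gx: "gx i y = \<omega> i / c i * (\<phi> y - 2 * (\<phi> y * q))"
    by (simp add: gx_def \<phi>_def q_def power2_eq_square ac_simps)
  have "\<phi> y * q \<le> \<alpha> / g * 1"
    using \<phi>_le[of y] \<phi>_nonneg[of y] q \<alpha>_pos g_pos by (intro mult_mono) auto
  moreover have "0 \<le> \<phi> y * q"
    using \<phi>_nonneg[of y] q by simp
  ultimately have "\<bar>\<phi> y - 2 * (\<phi> y * q)\<bar> \<le> 3 * (\<alpha> / g)"
    using \<phi>_le[of y] \<phi>_nonneg[of y] by linarith
  from mult_left_mono[OF this, of "\<omega> i / c i"] show ?thesis
    using \<omega>_pos[of i] c_pos[of i] by (simp add: gx abs_mult)
qed

lemma SA_div_P: "0 \<le> S y / P y * (A y / P y)" "S y / P y * (A y / P y) \<le> m / g"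
proof -
  show "0 \<le> S y / P y * (A y / P y)"
    using S_nonneg[of y] A_nonneg[of y] P_pos[of y] by simp
  show "S y / P y * (A y / P y) \<le> m / g"
    using mult_mono[OF S_div_P_le A_div_P_le, of y y] S_nonneg[of y] A_nonneg[of y] P_pos[of y] g_pos by simp
qed

text \<open>Here 7 = 1 + 2 + 4: the three terms in the brackets of \<open>gz\<close> have these
  coefficients, and each is at most m / g without its coefficient.\<close>

lemma gz_bound: "\<bar>gz k y\<bar> \<le> \<alpha>\<^sup>2 * (7 * m / g)"
proof -
  define a where "a = S y / P y * (A y / P y)"
  define b where "b = (snd y $ k)\<^sup>2 / P y * (A y / P y)"
  define q where "q = g * S y / P y"
  have gz: "gz k y = \<alpha>\<^sup>2 * (a + 2 * b - 4 * (q * b))"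
    by (simp add: gz_def a_def b_def q_def power2_eq_square power3_eq_cube algebra_simps)
  have q: "0 \<le> q" "q \<le> 1"
    using gS_div_P_le[of y] g_pos S_nonneg[of y] P_pos[of y] by (auto simp: q_def)
  have b: "0 \<le> b" "b \<le> m / g"
    using mult_mono[OF z_div_P_le[of y k] A_div_P_le[of y]] A_nonneg[of y] P_pos[of y] g_pos by (simp_all add: b_def)
  have "q * b \<le> 1 * (m / g)" "0 \<le> q * b"
    using mult_mono[OF q(2) b(2)] q b by auto
  then have "\<bar>a + 2 * b - 4 * (q * b)\<bar> \<le> 7 * (m / g)"
    using b SA_div_P[of y] unfolding a_def[symmetric] by linarith
  from mult_left_mono[OF this, of "\<alpha>\<^sup>2"] show ?thesis
    by (simp add: gz abs_mult)
qed

text \<open>Both traces carry the nonnegative factor \<alpha> S / P. Apart from it the x-part is s -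
  2 A / P, and the z-part is at most (n + 2) \<alpha> A / P, so what remains is increasing in A / P.
  Replacing A / P by its bound \<open>m\<close> gives exactly the assumed inequality.\<close>

lemma divergence_nonpos:
  fixes y :: "(real^'p) \<times> (real^'n::finite)"
  assumes cond: "((real CARD('n) + 2) * \<alpha> + 4) * m \<le> 2 * (\<Sum>i\<in>UNIV. \<omega> i / c i)"
  shows "(\<Sum>k\<in>UNIV. gz k y) - 2 * (\<Sum>i\<in>UNIV. gx i y) \<le> 0"
proof -
  define s where "s = (\<Sum>i\<in>UNIV. \<omega> i / c i)"
  define n where "n = real CARD('n)"
  have "(\<Sum>i\<in>UNIV. gx i y) = s * \<phi> y - 2 * \<alpha> * S y / (P y)\<^sup>2 * A y"
    unfolding gx_def s_def A_def sum_distrib_left sum_distrib_right sum_subtractf[symmetric]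
    by (rule sum.cong) (auto simp: algebra_simps power2_eq_square)
  also have "\<dots> = \<alpha> * (S y / P y) * (s - 2 * (A y / P y))"
    by (simp add: \<phi>_def power2_eq_square algebra_simps)
  finally have x: "(\<Sum>i\<in>UNIV. gx i y) = \<alpha> * (S y / P y) * (s - 2 * (A y / P y))" .
  have alg: "t * (((n + 2) * \<alpha> + 4) * r - 2 * s) = t * ((n + 2) * \<alpha> * r) - 2 * (t * (s - 2 * r))"
    for t r :: real
    by (simp add: algebra_simps)
  have "(\<Sum>k\<in>UNIV. gz k y) = \<alpha>\<^sup>2 * A y * (n * (S y / (P y)\<^sup>2) + 2 * S y / (P y)\<^sup>2
     - 4 * g * S y * S y / (P y) ^ 3)"
    unfolding gz_def sum_distrib_left[symmetric] sum_subtractf sum.distrib sum_divide_distrib[symmetric]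
      S_eq[symmetric] by (simp add: n_def)
  \<comment> \<open>The discarded term comes from differentiating P in z and is nonpositive.\<close>
  also have "\<dots> \<le> \<alpha>\<^sup>2 * A y * (n * (S y / (P y)\<^sup>2) + 2 * S y / (P y)\<^sup>2)"
    using A_nonneg[of y] S_nonneg[of y] P_pos[of y] g_pos by (intro mult_left_mono) auto
  also have "\<dots> = \<alpha> * (S y / P y) * ((n + 2) * \<alpha> * (A y / P y))"
    using P_pos[of y] by (simp add: power2_eq_square field_simps)
  finally have "(\<Sum>k\<in>UNIV. gz k y) - 2 * (\<Sum>i\<in>UNIV. gx i y) \<le>
      \<alpha> * (S y / P y) * (((n + 2) * \<alpha> + 4) * (A y / P y) - 2 * s)"
    unfolding x using alg[of "\<alpha> * (S y / P y)" "A y / P y"] by linarith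
  also have "\<dots> \<le> 0"
  proof (rule mult_nonneg_nonpos)
    show "0 \<le> \<alpha> * (S y / P y)"
      using \<alpha>_pos S_nonneg[of y] P_pos[of y] by simp
    have "((n + 2) * \<alpha> + 4) * (A y / P y) \<le> ((n + 2) * \<alpha> + 4) * m"
      using \<alpha>_pos by (intro mult_left_mono A_div_P_le) (simp add: n_def)
    then show "((n + 2) * \<alpha> + 4) * (A y / P y) - 2 * s \<le> 0"
      using cond unfolding n_def s_def by linarith
  qed
  finally show ?thesis .
qed

lemma loss_decomposition:
  fixes y :: "(real^'p) \<times> (real^'n::finite)"
  shows "(\<Sum>i\<in>UNIV. \<omega> i * (\<xi> i y - \<phi> y * \<xi> i y / c i - \<eta> i)\<^sup>2) =
    (\<Sum>i\<in>UNIV. \<omega> i * (fst y $ i)\<^sup>2) +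
    ((\<Sum>k\<in>UNIV. snd y $ k * hz k y) - 2 * (\<Sum>i\<in>UNIV. fst y $ i * hx i y))"
proof -
  \<comment> \<open>\<open>hz\<close> contains only one power of S; summing the squares of the
    z-coordinates supplies the second.\<close>
  have "(\<Sum>k\<in>UNIV. snd y $ k * hz k y) = \<alpha>\<^sup>2 * S y * A y / (P y)\<^sup>2 * (\<Sum>k\<in>UNIV. (snd y $ k)\<^sup>2)"
    unfolding sum_distrib_left hz_def by (rule sum.cong) (auto simp: power2_eq_square)
  also have "\<dots> = (\<phi> y)\<^sup>2 * A y"
    unfolding S_eq[symmetric] by (simp add: \<phi>_def power2_eq_square)
  finally have z: "(\<Sum>k\<in>UNIV. snd y $ k * hz k y) = (\<phi> y)\<^sup>2 * A y" .
  show ?thesis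
    unfolding z A_def sum_distrib_left sum.distrib[symmetric] sum_subtractf[symmetric]
  proof (rule sum.cong)
    fix i
    have "\<omega> i * (\<xi> i y - \<phi> y * \<xi> i y / c i - \<eta> i)\<^sup>2 = \<omega> i * (fst y $ i - \<phi> y * \<xi> i y / c i)\<^sup>2"
      by (simp add: \<xi>_def)
    then show "\<omega> i * (\<xi> i y - \<phi> y * \<xi> i y / c i - \<eta> i)\<^sup>2 = \<omega> i * (fst y $ i)\<^sup>2 +
        ((\<phi> y)\<^sup>2 * (\<omega> i * (\<xi> i y)\<^sup>2 / (c i)\<^sup>2) - 2 * (fst y $ i * hx i y))"
      using c_pos[of i] by (simp add: hx_def power2_eq_square field_simps)
  qed simp
qed

lemma hx_deriv:
  fixes y :: "(real^'p) \<times> (real^'n::finite)"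
  shows "((\<lambda>t. hx i (y + t *\<^sub>R (axis i 1, 0))) has_real_derivative gx i y) (at 0)"
proof -
  have \<xi>: "\<xi> j (y + t *\<^sub>R (axis i 1, 0)) = \<xi> j y + (if j = i then t else 0)" for j t
    by (simp add: \<xi>_def axis_def)
  have S: "S (y + t *\<^sub>R (axis i 1, 0)) = S y" for t
    by (simp add: S_def)
  have dB: "((\<lambda>t. B (y + t *\<^sub>R (axis i 1, 0))) has_real_derivative 2 * \<xi> i y / c i) (at 0)"
  proof -
    have "((\<lambda>t. \<Sum>j\<in>UNIV. (\<xi> j y + (if j = i then t else 0))\<^sup>2 / c j) has_real_derivative
        (\<Sum>j\<in>UNIV. if j = i then 2 * \<xi> i y / c i else 0)) (at 0)"
    proof (rule DERIV_sum)
      fix j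
      show "((\<lambda>t. (\<xi> j y + (if j = i then t else 0))\<^sup>2 / c j) has_real_derivative
          (if j = i then 2 * \<xi> i y / c i else 0)) (at 0)"
        using c_pos[of i] by (auto intro!: derivative_eq_intros)
    qed
    also have "(\<Sum>j\<in>UNIV. if j = i then 2 * \<xi> i y / c i else 0) = 2 * \<xi> i y / c i"
      by simp
    finally show ?thesis
      unfolding B_def \<xi> .
  qed
  define b where "b t = P (y + t *\<^sub>R (axis i 1, 0))" for t
  have at_0: "b 0 = P y"
    unfolding b_def by (simp flip: zero_prod_def)
  have db: "(b has_real_derivative 2 * \<xi> i y / c i) (at 0)"
    unfolding b_def[abs_def] P_def S by (rule derivative_eq_intros dB refl)+ simp
  have "((\<lambda>t. \<omega> i / c i * (\<alpha> * S y / b t * (\<xi> i y + t))) has_real_derivative gx i y) (at 0)"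
    apply (rule DERIV_cong)
     apply (rule derivative_intros db)+
    using P_pos[of y] apply (simp add: at_0)
     apply (rule derivative_intros)+
    using P_pos[of y] c_pos[of i]
    apply (simp add: gx_def \<phi>_def at_0 field_simps power2_eq_square)
    done
  then show ?thesis
    unfolding hx_def \<phi>_def \<xi> S b_def by simp
qed

lemma hz_deriv:
  fixes y :: "(real^'p) \<times> (real^'n::finite)"
  shows "((\<lambda>t. hz k (y + t *\<^sub>R (0, axis k 1))) has_real_derivative gz k y) (at 0)"
proof -
  have \<xi>: "\<xi> j (y + t *\<^sub>R (0, axis k 1)) = \<xi> j y" for j t
    by (simp add: \<xi>_def)
  have S: "S (y + t *\<^sub>R (0, axis k 1)) = S y + 2 * (snd y $ k) * t + t * t" for t
    by (simp add: S_def inner_simps inner_axis_axis inner_axis inner_axis' algebra_simps)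
  have A: "A (y + t *\<^sub>R (0, axis k 1)) = A y" and B: "B (y + t *\<^sub>R (0, axis k 1)) = B y" for t
    unfolding A_def B_def \<xi> by simp_all
  define s d where "s t = S y + 2 * (snd y $ k) * t + t * t" and "d t = g * s t + B y + \<epsilon>" for t
  have at_0: "s 0 = S y" "d 0 = P y"
    by (simp_all add: s_def d_def P_def)
  have ds: "(s has_real_derivative 2 * (snd y $ k)) (at 0)"
    unfolding s_def[abs_def] by (auto intro!: derivative_eq_intros)
  have dd: "(d has_real_derivative 2 * g * (snd y $ k)) (at 0)"
    unfolding d_def[abs_def] by (auto intro!: derivative_eq_intros ds)
  have "((\<lambda>t. \<alpha>\<^sup>2 * ((snd y $ k + t) * s t * A y / (d t)\<^sup>2)) has_real_derivative gz k y) (at 0)"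
    apply (rule DERIV_cong)
     apply (rule derivative_intros ds dd)+
    using P_pos[of y] apply (simp add: at_0)
    using P_pos[of y]
    apply (simp add: gz_def at_0 field_simps power2_eq_square power3_eq_cube)
    done
  then show ?thesis
    unfolding hz_def P_def A B S s_def d_def by simp
qed

section \<open>Measurability and growth of the vector field\<close>

lemma \<xi>_measurable [measurable]: "\<xi> i \<in> borel_measurable borel"
  unfolding \<xi>_def[abs_def] by measurable
lemma S_measurable [measurable]: "S \<in> borel_measurable borel"
  unfolding S_eq[abs_def] by measurable
lemma B_measurable [measurable]: "B \<in> borel_measurable borel"
  unfolding B_def[abs_def] by measurable
lemma A_measurable [measurable]: "A \<in> borel_measurable borel"
  unfolding A_def[abs_def] by measurable
lemma P_measurable [measurable]: "P \<in> borel_measurable borel"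
  unfolding P_def[abs_def] by measurable
lemma \<phi>_measurable [measurable]: "\<phi> \<in> borel_measurable borel"
  unfolding \<phi>_def[abs_def] by measurable
lemma hx_measurable [measurable]: "hx i \<in> borel_measurable borel"
  unfolding hx_def[abs_def] by measurable
lemma gx_measurable [measurable]: "gx i \<in> borel_measurable borel"
  unfolding gx_def[abs_def] by measurable
lemma hz_measurable [measurable]: "hz k \<in> borel_measurable borel"
  unfolding hz_def[abs_def] by measurable
lemma gz_measurable [measurable]: "gz k \<in> borel_measurable borel"
  unfolding gz_def[abs_def] by measurable

text \<open>Provides an integrable majorant: \<phi> is bounded and \<xi> is affine, so the product
  grows at most quadratically. The linear term is absorbed by |u| \<le> 1 + u^2.\<close>

lemma hx_growth: "\<bar>fst y $ i * hx i y\<bar> \<le> \<omega> i / c i * (\<alpha> / g) * (\<bar>\<eta> i\<bar> + (1 + \<bar>\<eta> i\<bar>) * (fst y $ i)\<^sup>2)"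
proof -
  define u where "u = fst y $ i"
  have u: "\<bar>u\<bar> \<le> 1 + u\<^sup>2"
    using zero_le_power2[of "\<bar>u\<bar> - 1"] by (simp add: power2_eq_square algebra_simps)
  have "\<bar>u\<bar> * \<bar>\<xi> i y\<bar> \<le> \<bar>u\<bar> * (\<bar>\<eta> i\<bar> + \<bar>u\<bar>)"
    unfolding \<xi>_def u_def by (intro mult_left_mono abs_triangle_ineq) auto
  also have "\<dots> = \<bar>\<eta> i\<bar> * \<bar>u\<bar> + u\<^sup>2"
    by (simp add: algebra_simps power2_eq_square)
  also have "\<dots> \<le> \<bar>\<eta> i\<bar> * (1 + u\<^sup>2) + u\<^sup>2"
    using u by (intro add_right_mono mult_left_mono) auto
  also have "\<dots> = \<bar>\<eta> i\<bar> + (1 + \<bar>\<eta> i\<bar>) * u\<^sup>2"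
    by (simp add: algebra_simps)
  finally have *: "\<bar>u\<bar> * \<bar>\<xi> i y\<bar> \<le> \<bar>\<eta> i\<bar> + (1 + \<bar>\<eta> i\<bar>) * u\<^sup>2" .
  have "\<bar>u * hx i y\<bar> = \<omega> i / c i * (\<phi> y * (\<bar>u\<bar> * \<bar>\<xi> i y\<bar>))"
    using \<omega>_pos[of i] c_pos[of i] \<phi>_nonneg[of y] by (simp add: hx_def abs_mult)
  also have "\<dots> \<le> \<omega> i / c i * (\<alpha> / g * (\<bar>\<eta> i\<bar> + (1 + \<bar>\<eta> i\<bar>) * u\<^sup>2))"
    using \<omega>_pos[of i] c_pos[of i] \<alpha>_pos g_pos
    by (intro mult_left_mono mult_mono \<phi>_le *) auto
  finally show ?thesis
    by (simp add: u_def)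
qed

lemma hz_growth: "\<bar>snd y $ k * hz k y\<bar> \<le> \<alpha>\<^sup>2 * (m / g) * (snd y $ k)\<^sup>2"
proof -
  define r where "r = S y / P y * (A y / P y)"
  have r: "0 \<le> r" "r \<le> m / g"
    using SA_div_P[of y] by (auto simp: r_def)
  have "\<bar>snd y $ k * hz k y\<bar> = \<bar>\<alpha>\<^sup>2 * r * (snd y $ k)\<^sup>2\<bar>"
    by (simp add: hz_def r_def power2_eq_square ac_simps)
  also have "\<dots> = \<alpha>\<^sup>2 * r * (snd y $ k)\<^sup>2"
    using r by simp
  also have "\<dots> \<le> \<alpha>\<^sup>2 * (m / g) * (snd y $ k)\<^sup>2"
    using r by (intro mult_right_mono mult_left_mono) auto
  finally show ?thesis .
qed

text \<open>The excess loss changes sign, so the comparison runs through Bochner integrals, with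
  integrability from the growth bounds. The conclusion returns to \<open>nn_integral\<close>, the
  form that Fatou's lemma needs when \<epsilon> tends to 0.\<close>

proposition dominates:
  fixes f :: "real \<Rightarrow> ennreal" and e\<^sub>0 :: "(real^'p) \<times> (real^'n::finite)"
  assumes f: "f \<in> borel_measurable borel"
    and fin: "emeasure (radial f) (UNIV :: ((real^'p) \<times> (real^'n)) set) < \<infinity>"
    and e\<^sub>0: "e\<^sub>0 \<in> Basis" and mom: "(\<integral>\<^sup>+y. ennreal ((y \<bullet> e\<^sub>0)\<^sup>2) \<partial>radial f) < \<infinity>"
    and cond: "((real CARD('n) + 2) * \<alpha> + 4) * m \<le> 2 * (\<Sum>i\<in>UNIV. \<omega> i / c i)"
  shows "(\<integral>\<^sup>+(y::(real^'p) \<times> (real^'n)).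
      ennreal (\<Sum>i\<in>UNIV. \<omega> i * (\<xi> i y - \<phi> y * \<xi> i y / c i - \<eta> i)\<^sup>2) \<partial>radial f)
    \<le> (\<integral>\<^sup>+(y::(real^'p) \<times> (real^'n)). ennreal (\<Sum>i\<in>UNIV. \<omega> i * (fst y $ i)\<^sup>2) \<partial>radial f)"
proof -
  let ?\<mu> = "radial f :: ((real^'p) \<times> (real^'n)) measure"
  let ?\<nu> = "radial (half_tail f) :: ((real^'p) \<times> (real^'n)) measure"
  interpret finite_measure ?\<mu>
    using fin by (intro finite_measureI) auto
  have fin': "emeasure ?\<nu> UNIV < \<infinity>"
    using mom emeasure_radial_half_tail[OF e\<^sub>0 f] by simp
  have sq: "integrable ?\<mu> (\<lambda>y. (y \<bullet> e)\<^sup>2)" if "e \<in> Basis" for e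
    using fin' emeasure_radial_half_tail[OF that f] by (intro integrableI_nonneg) auto
  have sq_x: "integrable ?\<mu> (\<lambda>y. (fst y $ i)\<^sup>2)" for i
    using sq[OF axis_fst_in_Basis] by (simp only: inner_axis_fst)
  have sq_z: "integrable ?\<mu> (\<lambda>y. (snd y $ k)\<^sup>2)" for k
    using sq[OF axis_snd_in_Basis] by (simp only: inner_axis_snd)
  have int_x: "integrable ?\<mu> (\<lambda>y. fst y $ i * hx i y)" for i
  proof (rule Bochner_Integration.integrable_bound)
    show "integrable ?\<mu> (\<lambda>y. \<omega> i / c i * (\<alpha> / g) * (\<bar>\<eta> i\<bar> + (1 + \<bar>\<eta> i\<bar>) * (fst y $ i)\<^sup>2))"
      using sq_x by (intro integrable_mult_right Bochner_Integration.integrable_add integrable_const)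
    show "AE y in ?\<mu>. norm (fst y $ i * hx i y) \<le> norm (\<omega> i / c i * (\<alpha> / g) * (\<bar>\<eta> i\<bar> + (1 + \<bar>\<eta> i\<bar>) * (fst y $ i)\<^sup>2))"
      unfolding real_norm_def by (intro always_eventually allI order_trans[OF hx_growth abs_ge_self])
  qed measurable
  have int_z: "integrable ?\<mu> (\<lambda>y. snd y $ k * hz k y)" for k
  proof (rule Bochner_Integration.integrable_bound)
    show "integrable ?\<mu> (\<lambda>y. \<alpha>\<^sup>2 * (m / g) * (snd y $ k)\<^sup>2)"
      using sq_z by (intro integrable_mult_right)
    show "AE y in ?\<mu>. norm (snd y $ k * hz k y) \<le> norm (\<alpha>\<^sup>2 * (m / g) * (snd y $ k)\<^sup>2)"
      unfolding real_norm_def by (intro always_eventually allI order_trans[OF hz_growth abs_ge_self])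
  qed measurable
  note sx = stein_identity[OF axis_fst_in_Basis f fin' hx_measurable hx_deriv gx_measurable gx_bound int_x[folded inner_axis_fst]]
  note sz = stein_identity[OF axis_snd_in_Basis f fin' hz_measurable hz_deriv gz_measurable gz_bound int_z[folded inner_axis_snd]]
  have int_R: "integrable ?\<mu> (\<lambda>y. \<Sum>i\<in>UNIV. \<omega> i * (fst y $ i)\<^sup>2)"
    using sq_x by (intro Bochner_Integration.integrable_sum integrable_mult_right)
  have int_V: "integrable ?\<mu> (\<lambda>y. (\<Sum>k\<in>UNIV. snd y $ k * hz k y) - 2 * (\<Sum>i\<in>UNIV. fst y $ i * hx i y))"
    using int_x int_z by (intro Bochner_Integration.integrable_diff Bochner_Integration.integrable_sum integrable_mult_right)
  have "(\<integral>y. (\<Sum>k\<in>UNIV. snd y $ k * hz k y) - 2 * (\<Sum>i\<in>UNIV. fst y $ i * hx i y) \<partial>?\<mu>) =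
      (\<Sum>k\<in>UNIV. \<integral>y. gz k y \<partial>?\<nu>) - 2 * (\<Sum>i\<in>UNIV. \<integral>y. gx i y \<partial>?\<nu>)"
    using int_x int_z by (simp add: sx(2) sz(2) inner_axis_fst inner_axis_snd)
  also have "\<dots> = (\<integral>y. (\<Sum>k\<in>UNIV. gz k y) - 2 * (\<Sum>i\<in>UNIV. gx i y) \<partial>?\<nu>)"
    using sx(1) sz(1) by simp
  also have "\<dots> \<le> 0"
    using integral_nonneg_AE[where M = ?\<nu> and f = "\<lambda>y. - ((\<Sum>k\<in>UNIV. gz k y) - 2 * (\<Sum>i\<in>UNIV. gx i y))"]
      divergence_nonpos[OF cond] by (simp del: minus_diff_eq)
  finally have V: "(\<integral>y. (\<Sum>k\<in>UNIV. snd y $ k * hz k y) - 2 * (\<Sum>i\<in>UNIV. fst y $ i * hx i y) \<partial>?\<mu>) \<le> 0" .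
  have R_nonneg: "0 \<le> (\<Sum>i\<in>UNIV. \<omega> i * (fst y $ i)\<^sup>2)" for y :: "(real^'p) \<times> (real^'n)"
    using \<omega>_pos by (intro sum_nonneg mult_nonneg_nonneg) (auto simp: less_imp_le)
  have L_nonneg: "0 \<le> (\<Sum>i\<in>UNIV. \<omega> i * (\<xi> i y - \<phi> y * \<xi> i y / c i - \<eta> i)\<^sup>2)" for y :: "(real^'p) \<times> (real^'n)"
    using \<omega>_pos by (intro sum_nonneg mult_nonneg_nonneg) (auto simp: less_imp_le)
  have int_L: "integrable ?\<mu> (\<lambda>y. \<Sum>i\<in>UNIV. \<omega> i * (\<xi> i y - \<phi> y * \<xi> i y / c i - \<eta> i)\<^sup>2)"
    unfolding loss_decomposition by (intro Bochner_Integration.integrable_add int_R int_V)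
  have "(\<integral>y. (\<Sum>i\<in>UNIV. \<omega> i * (\<xi> i y - \<phi> y * \<xi> i y / c i - \<eta> i)\<^sup>2) \<partial>?\<mu>) \<le>
      (\<integral>y. (\<Sum>i\<in>UNIV. \<omega> i * (fst y $ i)\<^sup>2) \<partial>?\<mu>)"
    unfolding loss_decomposition Bochner_Integration.integral_add[OF int_R int_V] using V by linarith
  then show ?thesis
    using int_L int_R L_nonneg R_nonneg by (simp add: nn_integral_eq_integral)
qed

end

text \<open>The limit \<epsilon> = 1 / (n + 1) of \<open>dominates\<close>. The right side does not
  depend on \<epsilon>, so Fatou's lemma suffices and no majorant for the losses has to be
  found.\<close>

proposition shrinkage_dominates:
  fixes f :: "real \<Rightarrow> ennreal" and \<eta> \<omega> c :: "'p::finite \<Rightarrow> real"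
    and e\<^sub>0 :: "(real^'p) \<times> (real^'n::finite)"
  assumes c_pos: "\<And>i. 0 < c i" and \<omega>_pos: "\<And>i. 0 < \<omega> i"
    and \<alpha>_pos: "0 < \<alpha>" and g_pos: "0 < g"
    and m_ge: "\<And>i. \<omega> i / c i \<le> m"
    and f [measurable]: "f \<in> borel_measurable borel"
    and fin: "emeasure (radial f) (UNIV :: ((real^'p) \<times> (real^'n)) set) < \<infinity>"
    and e\<^sub>0: "e\<^sub>0 \<in> Basis" and mom: "(\<integral>\<^sup>+y. ennreal ((y \<bullet> e\<^sub>0)\<^sup>2) \<partial>radial f) < \<infinity>"
    and cond: "((real CARD('n) + 2) * \<alpha> + 4) * m \<le> 2 * (\<Sum>i\<in>UNIV. \<omega> i / c i)"
  shows "(\<integral>\<^sup>+(y::(real^'p) \<times> (real^'n)). ennreal (\<Sum>i\<in>UNIV. \<omega> i * (\<eta> i + fst y $ i -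
        \<alpha> / (g + (\<Sum>i\<in>UNIV. (\<eta> i + fst y $ i)\<^sup>2 / c i) / (snd y \<bullet> snd y)) *
          (\<eta> i + fst y $ i) / c i - \<eta> i)\<^sup>2) \<partial>radial f)
    \<le> (\<integral>\<^sup>+(y::(real^'p) \<times> (real^'n)). ennreal (\<Sum>i\<in>UNIV. \<omega> i * (fst y $ i)\<^sup>2) \<partial>radial f)"
    (is "?L \<le> ?R")
proof -
  let ?\<mu> = "radial f :: ((real^'p) \<times> (real^'n)) measure"
  define \<epsilon> where "\<epsilon> n = 1 / real (Suc n)" for n
  have sh: "shrinkage \<omega> c \<alpha> g m (\<epsilon> n)" for n
    by unfold_locales (simp_all add: assms \<epsilon>_def)
  define \<xi> where "\<xi> = (shrinkage.\<xi> \<eta> :: 'p \<Rightarrow> (real^'p) \<times> (real^'n) \<Rightarrow> real)"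
  define B where "B = (shrinkage.B \<eta> c :: (real^'p) \<times> (real^'n) \<Rightarrow> real)"
  define \<phi> where "\<phi> n = (shrinkage.\<phi> \<eta> c \<alpha> g (\<epsilon> n) :: (real^'p) \<times> (real^'n) \<Rightarrow> real)" for n
  have \<xi>: "\<xi> i y = \<eta> i + fst y $ i" for i y
    by (simp add: \<xi>_def shrinkage.\<xi>_def[OF sh])
  have B: "B y = (\<Sum>i\<in>UNIV. (\<eta> i + fst y $ i)\<^sup>2 / c i)" for y
    by (simp add: B_def shrinkage.B_def[OF sh] \<xi>[unfolded \<xi>_def])
  have \<phi>: "\<phi> n y = \<alpha> * (snd y \<bullet> snd y) / (g * (snd y \<bullet> snd y) + B y + \<epsilon> n)" for n y
    by (simp add: \<phi>_def shrinkage.\<phi>_def[OF sh] shrinkage.P_def[OF sh] shrinkage.S_def[OF sh] B_def)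
  define L where "L n y = (\<Sum>i\<in>UNIV. \<omega> i * (\<xi> i y - \<phi> n y * \<xi> i y / c i - \<eta> i)\<^sup>2)" for n y
  have [measurable]: "\<phi> n \<in> borel_measurable borel" "\<xi> i \<in> borel_measurable borel" for n i
    by (simp_all add: \<phi>_def \<xi>_def shrinkage.\<phi>_measurable[OF sh] shrinkage.\<xi>_measurable[OF sh])
  have [measurable]: "L n \<in> borel_measurable borel" for n
    unfolding L_def[abs_def] by measurable
  have L_le: "(\<integral>\<^sup>+y. ennreal (L n y) \<partial>?\<mu>) \<le> ?R" for n
    using shrinkage.dominates[OF sh f fin e\<^sub>0 mom cond, where \<eta> = \<eta>]
    by (simp add: L_def \<xi>_def \<phi>_def)
  \<comment> \<open>Where z = 0 the smoothed factors are all 0, whereas division by zero makes the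
    estimator shrink with factor \<alpha> / g. One nonvanishing z-coordinate avoids this set, and
    almost every point has it.\<close>
  have "AE y in (lborel :: ((real^'p) \<times> (real^'n)) measure). y \<bullet> (0, axis undefined 1) \<noteq> 0"
    by (rule AE_lborel_inner_neq_0[OF axis_snd_in_Basis])
  then have AE: "AE y in ?\<mu>. snd y \<noteq> 0"
    unfolding radial_def by (subst AE_density) (auto simp: inner_axis_snd elim!: eventually_mono)
  have "?L \<le> (\<integral>\<^sup>+y. liminf (\<lambda>n. ennreal (L n y)) \<partial>?\<mu>)"
  proof (rule nn_integral_mono_AE, use AE in eventually_elim)
    case (elim y)
    define s where "s = snd y \<bullet> snd y"
    have s: "0 < s"
      using elim by (simp add: s_def)
    have B_nonneg: "0 \<le> B y"
      unfolding B using c_pos by (intro sum_nonneg) (auto simp: less_imp_le)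
    have "\<epsilon> \<longlonglongrightarrow> 0"
      unfolding \<epsilon>_def[abs_def] by (rule LIMSEQ_Suc[OF lim_1_over_n])
    then have "(\<lambda>n. \<phi> n y) \<longlonglongrightarrow> \<alpha> * s / (g * s + B y + 0)"
      unfolding \<phi> s_def[symmetric] using s B_nonneg g_pos
      by (intro tendsto_intros) (auto intro!: add_pos_nonneg less_imp_neq[symmetric])
    also have "\<alpha> * s / (g * s + B y + 0) = \<alpha> / (g + B y / s)"
      using s by (simp add: field_simps)
    finally have lim: "(\<lambda>n. \<phi> n y) \<longlonglongrightarrow> \<alpha> / (g + B y / s)" .
    have "(\<lambda>n. ennreal (L n y)) \<longlonglongrightarrow>
        ennreal (\<Sum>i\<in>UNIV. \<omega> i * (\<xi> i y - \<alpha> / (g + B y / s) * \<xi> i y / c i - \<eta> i)\<^sup>2)"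
      unfolding L_def by (intro tendsto_ennrealI tendsto_intros lim) (use c_pos in \<open>auto simp: less_imp_neq[symmetric]\<close>)
    from lim_imp_Liminf[OF _ this] show ?case
      by (simp add: \<xi> B s_def)
  qed
  also have "\<dots> \<le> liminf (\<lambda>n. \<integral>\<^sup>+y. ennreal (L n y) \<partial>?\<mu>)"
    by (rule nn_integral_liminf) simp
  also have "\<dots> \<le> limsup (\<lambda>n. \<integral>\<^sup>+y. ennreal (L n y) \<partial>?\<mu>)"
    by (rule Liminf_le_Limsup) simp
  also have "\<dots> \<le> ?R"
    by (rule Limsup_bounded) (simp add: L_le)
  finally show ?thesis .
qed

subsection \<open>Reduction of the model to canonical coordinates\<close>

text \<open>\<open>matrix_inv\<close> is a Hilbert choice: the explicit inverse shows that the
  chosen matrix is an inverse, and uniqueness of inverses identifies the two.\<close>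

lemma matrix_inv_diag:
  fixes a :: "'p::finite \<Rightarrow> real"
  assumes "\<And>i. a i \<noteq> 0"
  shows "matrix_inv (diag a) = diag (\<lambda>i. 1 / a i)"
proof -
  have mult: "diag a ** diag b = diag (\<lambda>i. a i * b i)" for a b :: "'p \<Rightarrow> real"
    by (simp add: diag_def matrix_matrix_mult_def vec_eq_iff mult_delta_left mult_delta_right)
  have one: "diag (\<lambda>i. 1) = (mat 1 :: real^'p^'p)"
    by (simp add: diag_def mat_def)
  have 1: "diag a ** diag (\<lambda>i. 1 / a i) = mat 1" "diag (\<lambda>i. 1 / a i) ** diag a = mat 1"
    using assms by (simp_all add: mult one)
  have "diag a ** matrix_inv (diag a) = mat 1 \<and> matrix_inv (diag a) ** diag a = mat 1"
    unfolding matrix_inv_def by (rule someI[of _ "diag (\<lambda>i. 1 / a i)"]) (use 1 in blast)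
  then have "matrix_inv (diag a) ** (diag a ** diag (\<lambda>i. 1 / a i)) = diag (\<lambda>i. 1 / a i)"
    by (simp add: matrix_mul_assoc)
  then show ?thesis
    by (simp add: 1)
qed

lemma diag_vector_mult: "diag a *v x = (\<chi> i. a i * x $ i)"
  by (simp add: diag_def matrix_vector_mult_def vec_eq_iff mult_delta_left)

text \<open>The values of \<open>f\<close> on negative arguments are arbitrary and possibly not measurable.\<close>

definition radial_gen :: "(real \<Rightarrow> real) \<Rightarrow> real \<Rightarrow> ennreal" where
  "radial_gen f t = indicator {0..} t * ennreal (f t)"

lemma radial_gen_measurable:
  assumes "f \<in> borel_measurable (restrict_space borel {0..})"
  shows "radial_gen f \<in> borel_measurable borel"
proof -
  have "(\<lambda>t. indicator {0..} t *\<^sub>R f t) \<in> borel_measurable borel"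
    using assms by (subst (asm) borel_measurable_restrict_space_iff) auto
  then have "(\<lambda>t. ennreal (indicator {0..} t *\<^sub>R f t)) \<in> borel_measurable borel"
    by measurable
  also have "(\<lambda>t. ennreal (indicator {0..} t *\<^sub>R f t)) = radial_gen f"
    by (auto simp: radial_gen_def indicator_def)
  finally show ?thesis .
qed

lemma model_eq_density:
  fixes d :: "'p::finite \<Rightarrow> real"
  assumes d: "\<And>i. 0 < d i" and \<sigma>: "0 < \<sigma>"
  shows "(model d f \<theta> \<sigma> :: ((real^'p) \<times> (real^'n::finite)) measure) = density lborel (\<lambda>y.
    ennreal ((\<Prod>i\<in>UNIV. d i powr (- 1 / 2)) * \<sigma> powr (- real CARD('p) - real CARD('n))) *
    radial_gen f (((\<Sum>i\<in>UNIV. (fst y $ i - \<theta> $ i)\<^sup>2 / d i) + snd y \<bullet> snd y) / \<sigma>\<^sup>2))"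
proof -
  have inv: "matrix_inv (diag d) = diag (\<lambda>i. 1 / d i)"
    by (rule matrix_inv_diag) (use d in \<open>simp add: less_imp_neq[symmetric]\<close>)
  have q: "x \<bullet> (matrix_inv (diag d) *v x) = (\<Sum>i\<in>UNIV. (x $ i)\<^sup>2 / d i)" for x :: "real^'p"
    by (simp add: inv diag_vector_mult inner_vec_def power2_eq_square)
  \<comment> \<open>The density evaluates \<open>f\<close> at nonnegative arguments only, where
    \<open>radial_gen f\<close> agrees with it.\<close>
  have "0 \<le> ((\<Sum>i\<in>UNIV. (x $ i)\<^sup>2 / d i) + z \<bullet> z) / \<sigma>\<^sup>2" for x :: "real^'p" and z :: "real^'n"
    using d by (intro divide_nonneg_nonneg add_nonneg_nonneg sum_nonneg) (auto simp: less_imp_le)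
  from this[of "_ - \<theta>"] show ?thesis
    unfolding model_def q
    by (intro arg_cong2[where f = density] refl ext)
      (auto simp: radial_gen_def ennreal_mult' prod_nonneg split: prod.split)
qed

text \<open>The Jacobian \<open>J\<close> of the substitution is the reciprocal of the normalizing
  constant \<open>K\<close>. The parameters thus leave the measure and survive only in the argument
  of \<open>G\<close>.\<close>

lemma nn_integral_model:
  fixes d :: "'p::finite \<Rightarrow> real" and G :: "(real^'p) \<times> (real^'n::finite) \<Rightarrow> ennreal"
  assumes d: "\<And>i. 0 < d i" and \<sigma>: "0 < \<sigma>"
    and f: "f \<in> borel_measurable (restrict_space borel {0..})"
    and [measurable]: "G \<in> borel_measurable borel"
  shows "(\<integral>\<^sup>+y. G y \<partial>model d f \<theta> \<sigma>) =
    (\<integral>\<^sup>+y. G (\<chi> i. \<theta> $ i + \<sigma> * sqrt (d i) * fst y $ i, \<sigma> *\<^sub>R snd y) \<partial>radial (radial_gen f))"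
proof -
  note [measurable] = radial_gen_measurable[OF f]
  define K where "K = (\<Prod>i\<in>UNIV. d i powr (- 1 / 2)) * \<sigma> powr (- real CARD('p) - real CARD('n))"
  define J where "J = (\<Prod>i\<in>UNIV. \<sigma> * sqrt (d i)) * \<sigma> ^ CARD('n)"
  define q where "q y = ((\<Sum>i\<in>UNIV. (fst y $ i - \<theta> $ i)\<^sup>2 / d i) + snd y \<bullet> snd y) / \<sigma>\<^sup>2"
    for y :: "(real^'p) \<times> (real^'n)"
  define T where "T y = (\<chi> i. \<theta> $ i + \<sigma> * sqrt (d i) * fst y $ i, \<sigma> *\<^sub>R snd y)" for y :: "(real^'p) \<times> (real^'n)"
  have JK: "J * K = 1"
  proof -
    have "(\<Prod>i\<in>UNIV. \<sigma> * sqrt (d i)) * (\<Prod>i\<in>UNIV. d i powr (- 1 / 2)) = (\<Prod>i\<in>(UNIV::'p set). \<sigma>)"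
      unfolding prod.distrib[symmetric] using d
      by (intro prod.cong) (auto simp: powr_half_sqrt[symmetric] powr_minus less_imp_le less_imp_neq[symmetric])
    then have "(\<Prod>i\<in>UNIV. \<sigma> * sqrt (d i)) * (\<Prod>i\<in>UNIV. d i powr (- 1 / 2)) = \<sigma> ^ CARD('p)"
      by simp
    moreover have "\<sigma> powr (- real CARD('p) - real CARD('n)) * (\<sigma> ^ CARD('p) * \<sigma> ^ CARD('n)) = 1"
      using \<sigma> by (simp add: powr_realpow[symmetric] powr_add[symmetric])
    moreover have "J * K = \<sigma> powr (- real CARD('p) - real CARD('n)) *
        ((\<Prod>i\<in>UNIV. \<sigma> * sqrt (d i)) * (\<Prod>i\<in>UNIV. d i powr (- 1 / 2)) * \<sigma> ^ CARD('n))"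
      unfolding J_def K_def by (simp only: ac_simps)
    ultimately show ?thesis
      by simp
  qed
  have K_pos: "0 \<le> K"
    unfolding K_def by (intro mult_nonneg_nonneg prod_nonneg) auto
  have J_pos: "0 \<le> J"
    unfolding J_def using \<sigma> d by (intro mult_nonneg_nonneg prod_nonneg) (auto simp: less_imp_le)
  have [measurable]: "q \<in> borel_measurable borel"
    unfolding q_def[abs_def] by measurable
  have [measurable]: "T \<in> borel_measurable borel"
    unfolding T_def[abs_def] by (intro borel_measurable_continuous_onI continuous_intros)
  have qT: "q (T y) = y \<bullet> y" for y
  proof -
    have "(\<Sum>i\<in>UNIV. (fst (T y) $ i - \<theta> $ i)\<^sup>2 / d i) = (\<Sum>i\<in>UNIV. \<sigma>\<^sup>2 * (fst y $ i)\<^sup>2)"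
      using d by (intro sum.cong) (auto simp: T_def power_mult_distrib less_imp_le less_imp_neq[symmetric])
    also have "\<dots> = \<sigma>\<^sup>2 * (fst y \<bullet> fst y)"
      by (simp add: inner_vec_def power2_eq_square sum_distrib_left)
    finally show ?thesis
      using \<sigma> by (simp add: q_def T_def inner_prod_def power2_eq_square field_simps)
  qed
  \<comment> \<open>The affine substitution wants one factor per basis vector of the product space:
    \<open>fst b = 0\<close> recognizes the z-directions, and at \<open>axis i 1\<close> the sum
    picks out \<open>sqrt (d i)\<close>.\<close>
  define c where "c b = \<sigma> * (if fst b = 0 then 1 else \<Sum>i\<in>UNIV. sqrt (d i) * fst b $ i)"
    for b :: "(real^'p) \<times> (real^'n)"
  have c: "c (axis i 1, 0) = \<sigma> * sqrt (d i)" "c (0, axis k 1) = \<sigma>" for i k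
    by (simp_all add: c_def axis_eq_0_iff) (simp add: axis_def mult_delta_right)
  have T: "(\<theta>, 0) + (\<Sum>b\<in>Basis. (c b * (y \<bullet> b)) *\<^sub>R b) = T y" for y
  proof (rule euclidean_eqI)
    fix b :: "(real^'p) \<times> (real^'n)" assume b: "b \<in> Basis"
    then have "((\<theta>, 0) + (\<Sum>b\<in>Basis. (c b * (y \<bullet> b)) *\<^sub>R b)) \<bullet> b = (\<theta>, 0) \<bullet> b + c b * (y \<bullet> b)"
      by (simp add: inner_add_left)
    also have "\<dots> = T y \<bullet> b"
      using b unfolding Basis_prod_vec
      by (auto simp: c inner_axis_fst inner_axis_snd T_def)
    finally show "((\<theta>, 0) + (\<Sum>b\<in>Basis. (c b * (y \<bullet> b)) *\<^sub>R b)) \<bullet> b = T y \<bullet> b" .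
  qed
  have c_nz: "c b \<noteq> 0" if "b \<in> Basis" for b
    using that \<sigma> d unfolding Basis_prod_vec by (auto simp: c less_imp_neq[symmetric])
  have prod_c: "(\<Prod>b\<in>Basis. \<bar>c b\<bar>) = J"
    using \<sigma> d by (simp add: prod_Basis_prod_vec c J_def abs_mult less_imp_le)
  have "(\<integral>\<^sup>+y. G y \<partial>model d f \<theta> \<sigma>) = (\<integral>\<^sup>+y. ennreal K * radial_gen f (q y) * G y \<partial>lborel)"
    unfolding model_eq_density[OF d \<sigma>] K_def[symmetric] q_def[symmetric]
    by (subst nn_integral_density) auto
  also have "\<dots> = ennreal J * (\<integral>\<^sup>+y. ennreal K * radial_gen f (q (T y)) * G (T y) \<partial>lborel)"
    using nn_integral_lborel_affine[OF c_nz, where g = "\<lambda>y. ennreal K * radial_gen f (q y) * G y" and t = "(\<theta>, 0)"]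
    by (simp add: T prod_c)
  also have "\<dots> = ennreal J * (ennreal K * (\<integral>\<^sup>+y. radial_gen f (y \<bullet> y) * G (T y) \<partial>lborel))"
    by (simp add: qT mult.assoc nn_integral_cmult)
  also have "\<dots> = (\<integral>\<^sup>+y. radial_gen f (y \<bullet> y) * G (T y) \<partial>lborel)"
    using J_pos K_pos by (simp add: mult.assoc[symmetric] ennreal_mult[symmetric] JK)
  also have "\<dots> = (\<integral>\<^sup>+y. G (T y) \<partial>radial (radial_gen f))"
    by (rule nn_integral_radial[symmetric]) auto
  finally show ?thesis
    by (simp add: T_def)
qed

section \<open>Loss, estimator and risk in coordinates\<close>

lemma loss_eq:
  "loss d j a \<theta> s = (\<Sum>i\<in>UNIV. d i powr (- j) * (a $ i - \<theta> $ i)\<^sup>2) / s"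
  by (simp add: loss_def diag_powr_def diag_vector_mult inner_vec_def power2_eq_square ac_simps)

lemma loss_measurable [measurable]:
  "(\<lambda>a. loss d j a \<theta> s) \<in> borel_measurable borel"
  unfolding loss_eq
  by (intro borel_measurable_divide borel_measurable_const borel_measurable_continuous_onI continuous_intros)

lemma theta_SB_nth:
  assumes d: "\<And>i. 0 < d i" and c: "\<And>i. 0 < c i"
  shows "theta_SB d c \<alpha> \<gamma> (x, z) $ i =
    x $ i - \<alpha> / (\<gamma> * (\<alpha> + 1) + (\<Sum>i\<in>UNIV. (x $ i)\<^sup>2 / (c i * d i)) / (z \<bullet> z)) * x $ i / c i"
proof -
  have inv: "matrix_inv (diag d) = diag (\<lambda>i. 1 / d i)" "matrix_inv (diag c) = diag (\<lambda>i. 1 / c i)"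
    by (intro matrix_inv_diag; use d c in \<open>simp add: less_imp_neq[symmetric]\<close>)+
  have "W_stat d c x z = (\<Sum>i\<in>UNIV. (x $ i)\<^sup>2 / (c i * d i)) / (z \<bullet> z)"
    by (simp add: W_stat_def inv matrix_vector_mul_assoc[symmetric] diag_vector_mult inner_vec_def power2_eq_square)
  then show ?thesis
    by (simp add: theta_SB_def inv matrix_vector_mult_diff_rdistrib scaleR_matrix_vector_assoc[symmetric] diag_vector_mult)
qed

lemma theta_SB_measurable:
  fixes d c :: "'p::finite \<Rightarrow> real"
  assumes d: "\<And>i. 0 < d i" and c: "\<And>i. 0 < c i"
  shows "(theta_SB d c \<alpha> \<gamma> :: (real^'p) \<times> (real^'n::finite) \<Rightarrow> real^'p) \<in> borel_measurable borel"
proof -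
  have "(\<lambda>y::(real^'p) \<times> (real^'n). \<chi> i. fst y $ i - \<alpha> / (\<gamma> * (\<alpha> + 1) +
      (\<Sum>i\<in>UNIV. (fst y $ i)\<^sup>2 / (c i * d i)) / (snd y \<bullet> snd y)) * fst y $ i / c i) \<in> borel_measurable borel"
    by (intro borel_measurable_vec_lambda) measurable
  also have "(\<lambda>y::(real^'p) \<times> (real^'n). \<chi> i. fst y $ i - \<alpha> / (\<gamma> * (\<alpha> + 1) +
      (\<Sum>i\<in>UNIV. (fst y $ i)\<^sup>2 / (c i * d i)) / (snd y \<bullet> snd y)) * fst y $ i / c i) = theta_SB d c \<alpha> \<gamma>"
    by (auto simp: vec_eq_iff theta_SB_nth[OF d c])
  finally show ?thesis .
qed

lemma risk_eq_radial:
  fixes d :: "'p::finite \<Rightarrow> real" and \<delta> :: "(real^'p) \<times> (real^'n::finite) \<Rightarrow> real^'p"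
  assumes "\<And>i. 0 < d i" "0 < \<sigma>" "f \<in> borel_measurable (restrict_space borel {0..})"
    and [measurable]: "\<delta> \<in> borel_measurable borel"
  shows "risk d f j \<delta> \<theta> \<sigma> = (\<integral>\<^sup>+y. ennreal (loss d j
      (\<delta> (\<chi> i. \<theta> $ i + \<sigma> * sqrt (d i) * fst y $ i, \<sigma> *\<^sub>R snd y)) \<theta> (\<sigma>\<^sup>2)) \<partial>radial (radial_gen f))"
  unfolding risk_def by (rule nn_integral_model) (use assms in auto)

text \<open>Origin of the weights \<open>d powr (1 - j)\<close>: the loss contributes the power -j,
  and rescaling a coordinate by \<open>sqrt (d i)\<close> contributes one more factor
  \<open>d i\<close>.\<close>

lemma powr_mult_self_eq:
  assumes "0 < (x::real)"
  shows "x powr (- j) * x = x powr (1 - j)"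
  using assms powr_add[of x "- j" 1] by (simp add: add.commute)

text \<open>Fixing \<sigma> = 1 leaves a pure location family, and a lower bound on this part of the
  parameter space bounds the full supremum. The left side is the risk of \<open>fst\<close> at
  \<theta> = 0.\<close>

lemma max_risk_ge:
  fixes d :: "'p::finite \<Rightarrow> real" and \<delta> :: "(real^'p) \<times> (real^'n::finite) \<Rightarrow> real^'p"
  assumes d: "\<And>i. 0 < d i" and f: "f \<in> borel_measurable (restrict_space borel {0..})"
    and \<delta> [measurable]: "\<delta> \<in> borel_measurable borel"
  shows "(\<integral>\<^sup>+(y::(real^'p) \<times> (real^'n)). ennreal (\<Sum>i\<in>UNIV. d i powr (1 - j) * (fst y $ i)\<^sup>2)
      \<partial>radial (radial_gen f)) \<le> max_risk d f j \<delta>"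
proof -
  note [measurable] = radial_gen_measurable[OF f]
  define Q where "Q e = ennreal (loss d j e 0 1)" for e :: "real^'p"
  define \<rho> where "\<rho> y = ennreal (\<Prod>i\<in>UNIV. d i powr (- 1 / 2)) *
    radial_gen f ((\<Sum>i\<in>UNIV. (fst y $ i)\<^sup>2 / d i) + snd y \<bullet> snd y)" for y :: "(real^'p) \<times> (real^'n)"
  have fst_m: "fst \<in> borel_measurable (borel :: ((real^'p) \<times> (real^'n)) measure)"
    by (intro borel_measurable_continuous_onI continuous_intros)
  have \<rho>_m: "\<rho> \<in> borel_measurable borel"
    unfolding \<rho>_def[abs_def] by measurable
  have Q_m: "Q \<in> borel_measurable borel"
    unfolding Q_def[abs_def] by measurable
  have model: "(model d f \<theta> 1 :: ((real^'p) \<times> (real^'n)) measure) =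
      density lborel (\<lambda>y. \<rho> (fst y - \<theta>, snd y))" for \<theta>
    by (subst model_eq_density[OF d]) (simp_all add: \<rho>_def)
  have [measurable]: "(\<lambda>y. \<rho> (fst y - \<theta>, snd y)) \<in> borel_measurable borel" for \<theta>
    by (rule measurable_compose[OF _ \<rho>_m]) (intro borel_measurable_continuous_onI continuous_intros)
  have risk: "risk d f j \<delta>' \<theta> 1 = (\<integral>\<^sup>+y. Q (\<delta>' y - \<theta>) * \<rho> (fst y - \<theta>, snd y) \<partial>lborel)"
    if [measurable]: "\<delta>' \<in> borel_measurable borel" for \<delta>' \<theta>
  proof -
    note [measurable] = Q_m
    have "ennreal (loss d j a \<theta> (1\<^sup>2)) = Q (a - \<theta>)" for a
      by (simp add: Q_def loss_eq)
    then show ?thesis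
      unfolding risk_def model by (simp add: nn_integral_density mult.commute)
  qed
  have "(\<integral>\<^sup>+(y::(real^'p) \<times> (real^'n)). ennreal (\<Sum>i\<in>UNIV. d i powr (1 - j) * (fst y $ i)\<^sup>2)
      \<partial>radial (radial_gen f)) = risk d f j (fst :: (real^'p) \<times> (real^'n) \<Rightarrow> real^'p) 0 1"
    unfolding risk_eq_radial[OF d zero_less_one f fst_m]
    using d by (simp add: loss_eq power_mult_distrib less_imp_le powr_mult_self_eq[symmetric] mult.assoc)
  also have "\<dots> = (\<integral>\<^sup>+y. Q (fst y) * \<rho> y \<partial>lborel)"
    by (simp add: risk[OF fst_m])
  also have "\<dots> \<le> max_risk d f j \<delta>"
  proof (rule location_lower_bound[OF \<delta> \<rho>_m Q_m])
    show "\<rho> (- u, z) = \<rho> (u, z)" for u z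
      by (simp add: \<rho>_def)
    show "2 * Q u \<le> Q (e + u) + Q (e - u)" for e u
    proof -
      have Q: "Q e = ennreal (\<Sum>i\<in>UNIV. d i powr (- j) * (e $ i)\<^sup>2)" for e
        by (simp add: Q_def loss_eq)
      have nonneg: "0 \<le> (\<Sum>i\<in>UNIV. d i powr (- j) * (e $ i)\<^sup>2)" for e :: "real^'p"
        by (intro sum_nonneg) auto
      have "2 * (\<Sum>i\<in>UNIV. d i powr (- j) * (u $ i)\<^sup>2) \<le> (\<Sum>i\<in>UNIV. d i powr (- j) * ((e + u) $ i)\<^sup>2) +
          (\<Sum>i\<in>UNIV. d i powr (- j) * ((e - u) $ i)\<^sup>2)"
        unfolding sum_distrib_left sum.distrib[symmetric]
      proof (rule sum_mono)
        fix i
        \<comment> \<open>By the parallelogram identity the right bracket equals twice the sum of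
          both squares.\<close>
        have "d i powr (- j) * (2 * (u $ i)\<^sup>2) \<le> d i powr (- j) * (((e + u) $ i)\<^sup>2 + ((e - u) $ i)\<^sup>2)"
          by (intro mult_left_mono) (auto simp: power2_eq_square algebra_simps)
        then show "2 * (d i powr (- j) * (u $ i)\<^sup>2) \<le>
            d i powr (- j) * ((e + u) $ i)\<^sup>2 + d i powr (- j) * ((e - u) $ i)\<^sup>2"
          by (simp only: distrib_left mult.left_commute)
      qed
      then have "ennreal (2 * (\<Sum>i\<in>UNIV. d i powr (- j) * (u $ i)\<^sup>2)) \<le>
          ennreal ((\<Sum>i\<in>UNIV. d i powr (- j) * ((e + u) $ i)\<^sup>2) +
            (\<Sum>i\<in>UNIV. d i powr (- j) * ((e - u) $ i)\<^sup>2))"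
        by (rule ennreal_leI)
      then show ?thesis
        unfolding Q by (simp only: ennreal_plus nonneg ennreal_mult' zero_le_numeral ennreal_numeral)
    qed
    show "(\<integral>\<^sup>+y. Q (\<delta> y - \<theta>) * \<rho> (fst y - \<theta>, snd y) \<partial>lborel) \<le> max_risk d f j \<delta>" for \<theta>
      unfolding risk[OF \<delta>, symmetric] max_risk_def by (intro SUP_upper2[of "(\<theta>, 1)"]) auto
  qed
  finally show ?thesis .
qed

theorem corollary2p4:
  fixes d c :: "'p::{finite,linorder} \<Rightarrow> real"
    and f :: "real \<Rightarrow> real"
    and \<alpha> \<gamma> j :: real
  assumes d_decreasing: "\<And>i k. i \<le> k \<Longrightarrow> d k \<le> d i"
    and d_pos: "\<And>i. 0 < d i"
    and c_ge_1: "\<And>i. 1 \<le> c i"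
    and gamma_ge_1: "1 \<le> \<gamma>"
    and f_nonneg: "\<And>t. 0 \<le> t \<Longrightarrow> 0 \<le> f t"
    and f_measurable: "f \<in> borel_measurable (restrict_space borel {0..})"
    and is_density: "\<And>\<theta> \<sigma>. 0 < \<sigma> \<Longrightarrow>
      prob_space (model d f \<theta> \<sigma> :: ((real, 'p) vec \<times> (real^'n::finite)) measure)"
    and second_moments: "\<And>\<theta> \<sigma> i. 0 < \<sigma> \<Longrightarrow>
      integrable (model d f \<theta> \<sigma> :: ((real, 'p) vec \<times> (real^'n)) measure) (\<lambda>(x, z). (x $ i)\<^sup>2)"
    and alpha_pos: "0 < \<alpha>"
    and alpha_le: "\<alpha> \<le> 2 / (real CARD('n) + 2) *
      ((\<Sum>i\<in>UNIV. d i powr (1 - j) / c i) / (MAX i. d i powr (1 - j) / c i) - 2)"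
  shows "minimax d f j (theta_SB d c \<alpha> \<gamma> :: (real, 'p) vec \<times> (real^'n) \<Rightarrow> (real, 'p) vec)"
proof -
  let ?\<mu> = "radial (radial_gen f) :: (((real, 'p) vec) \<times> (real^'n)) measure"
  let ?M = "model d f 0 1 :: (((real, 'p) vec) \<times> (real^'n)) measure"
  let ?\<delta> = "theta_SB d c \<alpha> \<gamma> :: ((real, 'p) vec) \<times> (real^'n) \<Rightarrow> (real, 'p) vec"
  define m where "m = (MAX i. d i powr (1 - j) / c i)"
  define g where "g = \<gamma> * (\<alpha> + 1)"
  \<comment> \<open>The risk of X in canonical coordinates. It bounds the risk of the shrinkage
    estimator from above at every parameter and the maximal risk of every measurable estimator from
    below.\<close>
  define R where "R = (\<integral>\<^sup>+y. ennreal (\<Sum>i\<in>UNIV. d i powr (1 - j) * (fst y $ i)\<^sup>2) \<partial>?\<mu>)"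
  have c_pos: "0 < c i" for i
    using c_ge_1[of i] by linarith
  have g_pos: "0 < g"
    using gamma_ge_1 alpha_pos by (simp add: g_def)
  have m_ge: "d i powr (1 - j) / c i \<le> m" for i
    unfolding m_def by (intro Max_ge) auto
  have "0 < d undefined powr (1 - j) / c undefined"
    using d_pos[of undefined] c_pos[of undefined] by simp
  then have m_pos: "0 < m"
    using m_ge by (rule less_le_trans)
  \<comment> \<open>This is \<open>alpha_le\<close> multiplied by the positive number (n + 2)
    m.\<close>
  have cond: "((real CARD('n) + 2) * \<alpha> + 4) * m \<le> 2 * (\<Sum>i\<in>UNIV. d i powr (1 - j) / c i)"
  proof -
    have "\<alpha> * (real CARD('n) + 2) \<le> 2 * ((\<Sum>i\<in>UNIV. d i powr (1 - j) / c i) / m - 2)"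
      using alpha_le unfolding m_def[symmetric] by (simp add: field_simps)
    then have "(\<alpha> * (real CARD('n) + 2) + 4) * m \<le> 2 * ((\<Sum>i\<in>UNIV. d i powr (1 - j) / c i) / m) * m"
      using m_pos by (intro mult_right_mono) auto
    then show ?thesis
      using m_pos by (simp add: mult.commute)
  qed
  have "emeasure ?\<mu> UNIV = (\<integral>\<^sup>+y. 1 \<partial>?M)"
    by (subst nn_integral_model[OF d_pos _ f_measurable]) auto
  also have "\<dots> = 1"
    using prob_space.emeasure_space_1[OF is_density[of 1 0]] by simp
  finally have fin: "emeasure ?\<mu> UNIV < \<infinity>"
    by simp
  \<comment> \<open>Any one location coordinate will do, because
    \<open>emeasure_radial_half_tail\<close> passes its second moment on to all the others.\<close>
  define i\<^sub>0 :: 'p where "i\<^sub>0 = undefined"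
  have "(\<integral>\<^sup>+y. ennreal ((fst y $ i\<^sub>0)\<^sup>2) \<partial>?M) < \<infinity>"
    using second_moments[of 1 0 i\<^sub>0] by (auto simp: integrable_iff_bounded split_beta)
  also have "(\<integral>\<^sup>+y. ennreal ((fst y $ i\<^sub>0)\<^sup>2) \<partial>?M) = (\<integral>\<^sup>+y. ennreal (d i\<^sub>0 * (fst y $ i\<^sub>0)\<^sup>2) \<partial>?\<mu>)"
  proof (subst nn_integral_model[OF d_pos _ f_measurable])
    show "(\<lambda>y::((real, 'p) vec) \<times> (real^'n). ennreal ((fst y $ i\<^sub>0)\<^sup>2)) \<in> borel_measurable borel"
      by measurable
  qed (use d_pos in \<open>simp_all add: power_mult_distrib less_imp_le\<close>)
  also have "\<dots> = ennreal (d i\<^sub>0) * (\<integral>\<^sup>+y. ennreal ((fst y $ i\<^sub>0)\<^sup>2) \<partial>?\<mu>)"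
  proof (subst nn_integral_cmult[symmetric])
    show "(\<lambda>y. ennreal ((fst y $ i\<^sub>0)\<^sup>2)) \<in> borel_measurable ?\<mu>"
      by simp
  qed (use d_pos in \<open>simp add: ennreal_mult' less_imp_le\<close>)
  finally have mom: "(\<integral>\<^sup>+y. ennreal ((y \<bullet> (axis i\<^sub>0 1, 0))\<^sup>2) \<partial>?\<mu>) < \<infinity>"
    using d_pos[of i\<^sub>0] unfolding inner_axis_fst by (auto simp: ennreal_mult_less_top)
  have risk_le: "risk d f j ?\<delta> \<theta> \<sigma> \<le> R" if \<sigma>: "0 < \<sigma>" for \<theta> \<sigma>
  proof -
    \<comment> \<open>After rescaling, the risk depends on \<theta> and \<sigma> only through
      \<eta>, and \<open>shrinkage_dominates\<close> holds for every \<eta>.\<close>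
    define \<eta> where "\<eta> i = \<theta> $ i / (\<sigma> * sqrt (d i))" for i
    have x: "\<theta> $ i + \<sigma> * sqrt (d i) * u = \<sigma> * sqrt (d i) * (\<eta> i + u)" for i u
      using \<sigma> d_pos[of i] by (simp add: \<eta>_def field_simps)
    have \<theta>: "\<theta> $ i = \<sigma> * sqrt (d i) * \<eta> i" for i
      using \<sigma> d_pos[of i] by (simp add: \<eta>_def)
    have "risk d f j ?\<delta> \<theta> \<sigma> = (\<integral>\<^sup>+y. ennreal (\<Sum>i\<in>UNIV. d i powr (1 - j) * (\<eta> i + fst y $ i -
        \<alpha> / (g + (\<Sum>i\<in>UNIV. (\<eta> i + fst y $ i)\<^sup>2 / c i) / (snd y \<bullet> snd y)) *
          (\<eta> i + fst y $ i) / c i - \<eta> i)\<^sup>2) \<partial>?\<mu>)"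
      unfolding risk_eq_radial[OF d_pos \<sigma> f_measurable theta_SB_measurable[OF d_pos c_pos]]
    proof (intro nn_integral_cong arg_cong[where f = ennreal])
      fix y :: "((real, 'p) vec) \<times> (real^'n)"
      define W where "W = (\<Sum>i\<in>UNIV. (\<eta> i + fst y $ i)\<^sup>2 / c i) / (snd y \<bullet> snd y)"
      have "(\<Sum>i\<in>UNIV. (\<sigma> * sqrt (d i) * (\<eta> i + fst y $ i))\<^sup>2 / (c i * d i)) =
          \<sigma>\<^sup>2 * (\<Sum>i\<in>UNIV. (\<eta> i + fst y $ i)\<^sup>2 / c i)"
        unfolding sum_distrib_left using d_pos
        by (intro sum.cong) (auto simp: power_mult_distrib less_imp_le less_imp_neq[symmetric])
      then have W: "(\<Sum>i\<in>UNIV. (\<sigma> * sqrt (d i) * (\<eta> i + fst y $ i))\<^sup>2 / (c i * d i)) /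
          ((\<sigma> *\<^sub>R snd y) \<bullet> (\<sigma> *\<^sub>R snd y)) = W"
        using \<sigma> by (simp add: W_def power2_eq_square)
      have "loss d j (?\<delta> (\<chi> i. \<theta> $ i + \<sigma> * sqrt (d i) * fst y $ i, \<sigma> *\<^sub>R snd y)) \<theta> (\<sigma>\<^sup>2) =
          (\<Sum>i\<in>UNIV. d i powr (- j) * (\<sigma> * sqrt (d i) * (\<eta> i + fst y $ i) -
            \<alpha> / (g + W) * (\<sigma> * sqrt (d i) * (\<eta> i + fst y $ i)) / c i - \<sigma> * sqrt (d i) * \<eta> i)\<^sup>2 / \<sigma>\<^sup>2)"
        unfolding loss_eq theta_SB_nth[OF d_pos c_pos] vec_lambda_beta x W g_def[symmetric]
        unfolding sum_divide_distrib \<theta>[symmetric] ..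
      also have "\<dots> = (\<Sum>i\<in>UNIV. d i powr (1 - j) * (\<eta> i + fst y $ i -
          \<alpha> / (g + W) * (\<eta> i + fst y $ i) / c i - \<eta> i)\<^sup>2)"
      proof (rule sum.cong)
        fix i
        have "\<sigma> * sqrt (d i) * (\<eta> i + fst y $ i) - \<alpha> / (g + W) * (\<sigma> * sqrt (d i) * (\<eta> i + fst y $ i)) / c i
            - \<sigma> * sqrt (d i) * \<eta> i =
          \<sigma> * sqrt (d i) * (\<eta> i + fst y $ i - \<alpha> / (g + W) * (\<eta> i + fst y $ i) / c i - \<eta> i)"
          by (simp add: algebra_simps)
        then show "d i powr (- j) * (\<sigma> * sqrt (d i) * (\<eta> i + fst y $ i) -
            \<alpha> / (g + W) * (\<sigma> * sqrt (d i) * (\<eta> i + fst y $ i)) / c i - \<sigma> * sqrt (d i) * \<eta> i)\<^sup>2 / \<sigma>\<^sup>2 =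
          d i powr (1 - j) * (\<eta> i + fst y $ i - \<alpha> / (g + W) * (\<eta> i + fst y $ i) / c i - \<eta> i)\<^sup>2"
          using \<sigma> d_pos[of i]
          by (simp add: power_mult_distrib powr_mult_self_eq[symmetric] less_imp_le)
      qed simp
      finally show "loss d j (?\<delta> (\<chi> i. \<theta> $ i + \<sigma> * sqrt (d i) * fst y $ i, \<sigma> *\<^sub>R snd y)) \<theta> (\<sigma>\<^sup>2) =
          (\<Sum>i\<in>UNIV. d i powr (1 - j) * (\<eta> i + fst y $ i -
          \<alpha> / (g + (\<Sum>i\<in>UNIV. (\<eta> i + fst y $ i)\<^sup>2 / c i) / (snd y \<bullet> snd y)) *
            (\<eta> i + fst y $ i) / c i - \<eta> i)\<^sup>2)"
        unfolding W_def .
    qed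
    also have "\<dots> \<le> R"
      unfolding R_def
      by (rule shrinkage_dominates[OF c_pos _ alpha_pos g_pos m_ge radial_gen_measurable[OF f_measurable]
            fin axis_fst_in_Basis mom cond]) (use d_pos in \<open>simp add: less_imp_neq[symmetric]\<close>)
    finally show ?thesis .
  qed
  have "max_risk d f j ?\<delta> \<le> R"
    unfolding max_risk_def using risk_le by (intro SUP_least) auto
  moreover have "R \<le> max_risk d f j \<delta>'" if "\<delta>' \<in> borel_measurable borel"
    for \<delta>' :: "((real, 'p) vec) \<times> (real^'n) \<Rightarrow> (real, 'p) vec"
    unfolding R_def by (rule max_risk_ge[OF d_pos f_measurable that])
  ultimately show ?thesis
    unfolding minimax_def
    by (intro conjI allI impI theta_SB_measurable[OF d_pos c_pos]) (rule order_trans)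
qed

end
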